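(* Let $(\Lambda,\pi)$ be an action operad with underlying permutation map $\pi:\Lambda\to\Sigma$. For any $\Lambda$-operad $P$ and any set $X$, $P$-algebra structures on $X$ are in bijection with - maps of $\Lambda$-operads $\alpha:P\to\pi^*\mathcal E_X$, or - maps of symmetric operads $\alpha':\pi_!P\to\mathcal E_X$.
   Context: $\mathbb N\ni 0$; $e_n$ is the identity of $\Lambda(n)$; permutations compose as functions. A (non-symmetric) operad $O$ in sets: sets $O(n)$ ($n\in\mathbb N$), $\mathrm{id}\in O(1)$, functions $\mu:O(n)\times O(k_1)\times\cdots\times O(k_n)\to O(k_1+\cdots+k_n)$, unital and associative in the usual sense; maps preserve $\mathrm{id}$ and $\mu$. The operad $\Sigma$ of symmetric groups has $\mu(\sigma;\tau_1,\dots,\tau_n)=\delta(\sigma)\cdot\beta(\tau_1,\dots,\tau_n)$, with $\beta$ the block sum of the permutations $\tau_i\in\Sigma_{k_i}$ and $\delta(\sigma)=\delta_{n;k_1,\dots,k_n}(\sigma)$ sending $k_1+\cdots+k_{i-1}+a$ ($1\le a\le k_i$) to $(\sum_{\sigma(i')<\sigma(i)}k_{i'})+a$. An action operad $(\Lambda,\pi)$: an operad $\Lambda$ in sets with a group structure on each $\Lambda(n)$ and a map of operads $\pi:\Lambda\to\Sigma$ whose components are group homomorphisms, such that, writing $g(i)=\pi_n(g)(i)$ and $g^{-1}(i)=\pi_n(g)^{-1}(i)$, $\mu(g';f_1',\dots,f_n')\mu(g;f_1,\dots,f_n)=\mu(g'g;f'_{g(1)}f_1,\dots,f'_{g(n)}f_n)$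 for $g,g'\in\Lambda(n)$, $f_i\in\Lambda(k_i)$, $f_i'\in\Lambda(k_{g^{-1}(i)})$. Put $\beta^\Lambda(g_1,\dots,g_n)=\mu(e_n;g_1,\dots,g_n)$ and $\delta^\Lambda_{n;k_1,\dots,k_n}(g)=\mu(g;e_{k_1},\dots,e_{k_n})$. A $\Lambda$-operad $P$ (in sets): a non-symmetric operad $P$ with a right action of $\Lambda(n)$ on $P(n)$ for each $n$ such that $\mu(p;q_1\cdot g_1,\dots,q_n\cdot g_n)=\mu(p;q_1,\dots,q_n)\cdot\beta^\Lambda(g_1,\dots,g_n)$ and $\mu(p\cdot g;q_1,\dots,q_n)=\mu(p;q_{g^{-1}(1)},\dots,q_{g^{-1}(n)})\cdot\delta^\Lambda_{n;k_1,\dots,k_n}(g)$ for $p\in P(n)$, $q_i\in P(k_i)$, $g_i\in\Lambda(k_i)$, $g\in\Lambda(n)$. Maps of $\Lambda$-operads are operad maps that are levelwise $\Lambda(n)$-equivariant. A symmetric operad is a $\Sigma$-operad ($\Sigma$ with $\pi=\mathrm{id}$). $\Lambda(n)$ acts on the left of $X^n$ by $g\cdot(x_1,\dots,x_n)=(x_{g^{-1}(1)},\dots,x_{g^{-1}(n)})$. $P(n)\otimes_{\Lambda(n)}X^n$ is the quotient of $P(n)\times X^n$ by $(p\cdot g,\underline x)\sim(p,g\cdot\underline x)$. A $P$-algebra structure on $X$: maps $\alpha_n:P(n)\otimes_{\Lambda(n)}X^n\to X$ whose corresponding maps $\tilde\alpha_n:P(n)\times X^n\to X$ satisfy $\tilde\alpha_1(\mathrm{id};x)=x$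 and $\tilde\alpha_n(p;\tilde\alpha_{k_1}(q_1;\underline{x_1}),\dots,\tilde\alpha_{k_n}(q_n;\underline{x_n}))=\tilde\alpha_{k_1+\cdots+k_n}(\mu(p;q_1,\dots,q_n);\underline{x_1},\dots,\underline{x_n})$. $\mathcal E_X$ is the endomorphism operad: $\mathcal E_X(n)$ is the set of functions $X^n\to X$, $(f\cdot\sigma)(x_1,\dots,x_n)=f(x_{\sigma^{-1}(1)},\dots,x_{\sigma^{-1}(n)})$, $\mathrm{id}=1_X$, $\mu(g;f_1,\dots,f_n)=g\circ(f_1\times\cdots\times f_n)$. The functor $\pi^*$ sends a symmetric operad $Q$ to the $\Lambda$-operad with the same underlying operad and $\Lambda(n)$ acting via $\pi_n$. The functor $\pi_!$ sends $P$ to the symmetric operad with $(\pi_!P)(n)=P(n)\otimes_{\Lambda(n)}\Sigma_n$ (quotient of $P(n)\times\Sigma_n$ by $[p\cdot g,\tau]=[p,\pi(g)\tau]$), right action by multiplication on the second factor, unit $[\mathrm{id},e_1]$ and multiplication $([p,\tau];[p_1,\tau_1],\dots,[p_n,\tau_n])\mapsto[\mu(p;p_{\tau^{-1}(1)},\dots,p_{\tau^{-1}(n)}),\mu^\Sigma(\tau;\tau_1,\dots,\tau_n)]$. *)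

theory Defs
  imports "HOL-Algebra.Group" "HOL-Combinatorics.Permutations"
begin

text \<open>
  Conventions. Positions in an $n$-tuple are numbered $0,\dots,n-1$, so that tuples are
  lists and \<open>\<Sigma>\<^sub>n\<close> is the set of permutations of \<open>{..<n}\<close>. The levels of an operad need not be
  disjoint, and the multiplication therefore takes the list of arities \<open>[k\<^sub>1, \<dots>, k\<^sub>n]\<close> as an
  explicit argument; the arity \<open>n\<close> of the first operation is the length of that list.
\<close>

section \<open>Non-symmetric operads\<close>

record 'a operad =
  ops :: "nat \<Rightarrow> 'a set"
  opid :: 'a
  mu :: "nat list \<Rightarrow> 'a \<Rightarrow> 'a list \<Rightarrow> 'a"

definition op_tuple :: "('a, 'm) operad_scheme \<Rightarrow> nat list \<Rightarrow> 'a list \<Rightarrow> bool" where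
  "op_tuple A ks qs \<longleftrightarrow> list_all2 (\<lambda>k q. q \<in> ops A k) ks qs"

text \<open>
  In the associativity law \<open>jss ! i\<close> lists the arities of the operations \<open>rss ! i\<close> that are
  inserted into \<open>qs ! i\<close>.
\<close>

locale operad =
  fixes A :: "('a, 'm) operad_scheme"
  assumes opid_closed: "opid A \<in> ops A 1"
    and mu_closed: "\<lbrakk>p \<in> ops A (length ks); op_tuple A ks qs\<rbrakk>
      \<Longrightarrow> mu A ks p qs \<in> ops A (sum_list ks)"
    and mu_id_left: "q \<in> ops A k \<Longrightarrow> mu A [k] (opid A) [q] = q"
    and mu_id_right: "p \<in> ops A n \<Longrightarrow> mu A (replicate n 1) p (replicate n (opid A)) = p"
    and mu_assoc: "\<lbrakk>p \<in> ops A (length jss); op_tuple A (map length jss) qs;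
        list_all2 (op_tuple A) jss rss\<rbrakk>
      \<Longrightarrow> mu A (concat jss) (mu A (map length jss) p qs) (concat rss)
        = mu A (map sum_list jss) p
            (map (\<lambda>i. mu A (jss ! i) (qs ! i) (rss ! i)) [0..<length jss])"

definition operad_hom ::
  "('a, 'm) operad_scheme \<Rightarrow> ('b, 'n) operad_scheme \<Rightarrow> (nat \<Rightarrow> 'a \<Rightarrow> 'b) \<Rightarrow> bool" where
  "operad_hom A B f \<longleftrightarrow>
     (\<forall>n. f n \<in> ops A n \<rightarrow> ops B n) \<and>
     f 1 (opid A) = opid B \<and>
     (\<forall>ks p qs. p \<in> ops A (length ks) \<longrightarrow> op_tuple A ks qs \<longrightarrow>
        f (sum_list ks) (mu A ks p qs) = mu B ks (f (length ks) p) (map2 f ks qs))"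

section \<open>Action operads\<close>

record 'g action_operad = "'g operad" +
  gmult :: "nat \<Rightarrow> 'g \<Rightarrow> 'g \<Rightarrow> 'g"
  gone :: "nat \<Rightarrow> 'g"
  perm :: "nat \<Rightarrow> 'g \<Rightarrow> nat \<Rightarrow> nat"

definition level_group :: "('g, 'm) action_operad_scheme \<Rightarrow> nat \<Rightarrow> 'g monoid" where
  "level_group L n = \<lparr>carrier = ops L n, monoid.mult = gmult L n, one = gone L n\<rparr>"

text \<open>\<open>\<sigma> \<cdot> (x\<^sub>1, \<dots>, x\<^sub>n)\<close> has \<open>i\<close>-th entry \<open>x\<close> at index \<open>\<sigma>\<^sup>-\<^sup>1(i)\<close>; this is a left action.\<close>

definition perm_tuple :: "(nat \<Rightarrow> nat) \<Rightarrow> 'a list \<Rightarrow> 'a list" where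
  "perm_tuple \<sigma> xs = permute_list (Hilbert_Choice.inv \<sigma>) xs"

definition block_start :: "nat list \<Rightarrow> nat \<Rightarrow> nat" where
  "block_start ks i = sum_list (take i ks)"

text \<open>For \<open>j < sum_list ks\<close>, the number of the block containing position \<open>j\<close>.\<close>

definition block_index :: "nat list \<Rightarrow> nat \<Rightarrow> nat" where
  "block_index ks j = (LEAST i. j < block_start ks (Suc i))"

definition block_sum :: "nat list \<Rightarrow> (nat \<Rightarrow> nat) list \<Rightarrow> nat \<Rightarrow> nat" where
  "block_sum ks \<tau>s j =
     (if j < sum_list ks
      then let i = block_index ks j; a = j - block_start ks i
           in block_start ks i + (\<tau>s ! i) a
      else j)"

definition block_perm :: "nat list \<Rightarrow> (nat \<Rightarrow> nat) \<Rightarrow> nat \<Rightarrow> nat" where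
  "block_perm ks \<sigma> j =
     (if j < sum_list ks
      then let i = block_index ks j; a = j - block_start ks i
           in (\<Sum>i' | i' < length ks \<and> \<sigma> i' < \<sigma> i. ks ! i') + a
      else j)"

definition sym_operad :: "(nat \<Rightarrow> nat) action_operad" where
  "sym_operad =
     \<lparr>ops = (\<lambda>n. {\<sigma>. \<sigma> permutes {..<n}}),
      opid = id,
      mu = (\<lambda>ks \<sigma> \<tau>s. block_perm ks \<sigma> \<circ> block_sum ks \<tau>s),
      gmult = (\<lambda>n \<sigma> \<tau>. \<sigma> \<circ> \<tau>),
      gone = (\<lambda>n. id),
      perm = (\<lambda>n \<sigma>. \<sigma>)\<rparr>"

locale action_operad = operad L
  for L :: "('g, 'm) action_operad_scheme" +
  assumes level_group: "group (level_group L n)"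
    and perm_operad_hom: "operad_hom L sym_operad (perm L)"
    and perm_group_hom: "perm L n \<in> hom (level_group L n) (level_group sym_operad n)"
    and mu_mult: "\<lbrakk>length ks = n; g \<in> ops L n; g' \<in> ops L n; op_tuple L ks fs;
        op_tuple L (perm_tuple (perm L n g) ks) fs'\<rbrakk>
      \<Longrightarrow> gmult L (sum_list ks)
            (mu L (perm_tuple (perm L n g) ks) g' fs')
            (mu L ks g fs)
        = mu L ks (gmult L n g' g)
            (map (\<lambda>i. gmult L (ks ! i) (fs' ! perm L n g i) (fs ! i)) [0..<n])"

definition beta :: "('g, 'm) action_operad_scheme \<Rightarrow> nat list \<Rightarrow> 'g list \<Rightarrow> 'g" where
  "beta L ks gs = mu L ks (gone L (length ks)) gs"

definition delta :: "('g, 'm) action_operad_scheme \<Rightarrow> nat list \<Rightarrow> 'g \<Rightarrow> 'g" where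
  "delta L ks g = mu L ks g (map (gone L) ks)"

section \<open>Operads with an action of an action operad\<close>

record ('p, 'g) equiv_operad = "'p operad" +
  act :: "nat \<Rightarrow> 'p \<Rightarrow> 'g \<Rightarrow> 'p"

locale equivariant_operad = L: action_operad L + operad P
  for L :: "('g, 'm) action_operad_scheme"
    and P :: "('p, 'g, 'n) equiv_operad_scheme" +
  assumes act_closed: "\<lbrakk>p \<in> ops P n; g \<in> ops L n\<rbrakk> \<Longrightarrow> act P n p g \<in> ops P n"
    and act_one: "p \<in> ops P n \<Longrightarrow> act P n p (gone L n) = p"
    and act_mult: "\<lbrakk>p \<in> ops P n; g \<in> ops L n; h \<in> ops L n\<rbrakk>
      \<Longrightarrow> act P n p (gmult L n g h) = act P n (act P n p g) h"
    and mu_act_right: "\<lbrakk>length ks = n; p \<in> ops P n; op_tuple P ks qs; op_tuple L ks gs\<rbrakk>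
      \<Longrightarrow> mu P ks p (map (\<lambda>i. act P (ks ! i) (qs ! i) (gs ! i)) [0..<n])
        = act P (sum_list ks) (mu P ks p qs) (beta L ks gs)"
    and mu_act_left: "\<lbrakk>length ks = n; p \<in> ops P n; op_tuple P ks qs; g \<in> ops L n\<rbrakk>
      \<Longrightarrow> mu P ks (act P n p g) qs
        = act P (sum_list ks)
            (mu P (perm_tuple (perm L n g) ks) p (perm_tuple (perm L n g) qs))
            (delta L ks g)"

text \<open>
  A map is a family of functions that are extensional, i.e. undefined off their domain, so that
  two maps are equal as soon as they agree on all operations.
\<close>

definition equiv_operad_maps ::
  "('g, 'm) action_operad_scheme \<Rightarrow> ('p, 'g, 'n) equiv_operad_scheme
    \<Rightarrow> ('q, 'g, 'k) equiv_operad_scheme \<Rightarrow> (nat \<Rightarrow> 'p \<Rightarrow> 'q) set" where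
  "equiv_operad_maps L P Q =
     {f. (\<forall>n. f n \<in> extensional (ops P n)) \<and> operad_hom P Q f \<and>
         (\<forall>n. \<forall>p \<in> ops P n. \<forall>g \<in> ops L n. f n (act P n p g) = act Q n (f n p) g)}"

abbreviation sym_operad_maps ::
  "('p, nat \<Rightarrow> nat, 'n) equiv_operad_scheme \<Rightarrow> ('q, nat \<Rightarrow> nat, 'k) equiv_operad_scheme
    \<Rightarrow> (nat \<Rightarrow> 'p \<Rightarrow> 'q) set" where
  "sym_operad_maps \<equiv> equiv_operad_maps sym_operad"

section \<open>Tensor products over a level group\<close>

text \<open>
  The equivalence relation on \<open>A \<times> B\<close> generated by \<open>(a \<cdot> g, b) \<sim> (a, g \<cdot> b)\<close> for \<open>g \<in> G\<close>.
\<close>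

definition tensor_rel ::
  "'g set \<Rightarrow> ('a \<Rightarrow> 'g \<Rightarrow> 'a) \<Rightarrow> ('g \<Rightarrow> 'b \<Rightarrow> 'b) \<Rightarrow> 'a set \<Rightarrow> 'b set
    \<Rightarrow> (('a \<times> 'b) \<times> ('a \<times> 'b)) set" where
  "tensor_rel G ra la A B =
     (let R = {((ra a g, b), (a, la g b)) | a g b. a \<in> A \<and> g \<in> G \<and> b \<in> B}
      in (R \<union> R\<inverse>)\<^sup>* \<inter> (A \<times> B) \<times> (A \<times> B))"

section \<open>Algebras\<close>

definition tuples :: "'x set \<Rightarrow> nat \<Rightarrow> 'x list set" where
  "tuples X n = {xs. length xs = n \<and> set xs \<subseteq> X}"

definition alg_rel ::
  "('g, 'm) action_operad_scheme \<Rightarrow> ('p, 'g, 'n) equiv_operad_scheme \<Rightarrow> 'x set \<Rightarrow> nat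
    \<Rightarrow> (('p \<times> 'x list) \<times> ('p \<times> 'x list)) set" where
  "alg_rel L P X n =
     tensor_rel (ops L n) (act P n) (\<lambda>g. perm_tuple (perm L n g)) (ops P n) (tuples X n)"

definition alg_tensor ::
  "('g, 'm) action_operad_scheme \<Rightarrow> ('p, 'g, 'n) equiv_operad_scheme \<Rightarrow> 'x set \<Rightarrow> nat
    \<Rightarrow> ('p \<times> 'x list) set set" where
  "alg_tensor L P X n = (ops P n \<times> tuples X n) // alg_rel L P X n"

definition alg_tilde ::
  "('g, 'm) action_operad_scheme \<Rightarrow> ('p, 'g, 'n) equiv_operad_scheme \<Rightarrow> 'x set
    \<Rightarrow> (nat \<Rightarrow> ('p \<times> 'x list) set \<Rightarrow> 'x) \<Rightarrow> nat \<Rightarrow> 'p \<Rightarrow> 'x list \<Rightarrow> 'x" where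
  "alg_tilde L P X \<alpha> n p xs = \<alpha> n (alg_rel L P X n `` {(p, xs)})"

definition algebra_structures ::
  "('g, 'm) action_operad_scheme \<Rightarrow> ('p, 'g, 'n) equiv_operad_scheme \<Rightarrow> 'x set
    \<Rightarrow> (nat \<Rightarrow> ('p \<times> 'x list) set \<Rightarrow> 'x) set" where
  "algebra_structures L P X =
     {\<alpha>. (\<forall>n. \<alpha> n \<in> alg_tensor L P X n \<rightarrow>\<^sub>E X) \<and>
         (\<forall>x \<in> X. alg_tilde L P X \<alpha> 1 (opid P) [x] = x) \<and>
         (\<forall>ks p qs xss.
            p \<in> ops P (length ks) \<longrightarrow> op_tuple P ks qs \<longrightarrow>
            list_all2 (\<lambda>k xs. xs \<in> tuples X k) ks xss \<longrightarrow>
            alg_tilde L P X \<alpha> (length ks) p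
              (map (\<lambda>i. alg_tilde L P X \<alpha> (ks ! i) (qs ! i) (xss ! i)) [0..<length ks])
            = alg_tilde L P X \<alpha> (sum_list ks) (mu P ks p qs) (concat xss))}"

section \<open>The endomorphism operad\<close>

fun split_blocks :: "nat list \<Rightarrow> 'x list \<Rightarrow> 'x list list" where
  "split_blocks [] xs = []"
| "split_blocks (k # ks) xs = take k xs # split_blocks ks (drop k xs)"

definition end_operad :: "'x set \<Rightarrow> ('x list \<Rightarrow> 'x, nat \<Rightarrow> nat) equiv_operad" where
  "end_operad X =
     \<lparr>ops = (\<lambda>n. tuples X n \<rightarrow>\<^sub>E X),
      opid = (\<lambda>xs \<in> tuples X 1. hd xs),
      mu = (\<lambda>ks f hs. \<lambda>xs \<in> tuples X (sum_list ks).
              f (map2 (\<lambda>h ys. h ys) hs (split_blocks ks xs))),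
      act = (\<lambda>n f \<sigma>. \<lambda>xs \<in> tuples X n. f (perm_tuple \<sigma> xs))\<rparr>"

section \<open>Change of action operad along the underlying permutations\<close>

definition pi_star ::
  "('g, 'm) action_operad_scheme \<Rightarrow> ('q, nat \<Rightarrow> nat, 'n) equiv_operad_scheme
    \<Rightarrow> ('q, 'g) equiv_operad" where
  "pi_star L Q =
     \<lparr>ops = ops Q, opid = opid Q, mu = mu Q, act = (\<lambda>n q g. act Q n q (perm L n g))\<rparr>"

definition pi_shriek_rel ::
  "('g, 'm) action_operad_scheme \<Rightarrow> ('p, 'g, 'n) equiv_operad_scheme \<Rightarrow> nat
    \<Rightarrow> (('p \<times> (nat \<Rightarrow> nat)) \<times> ('p \<times> (nat \<Rightarrow> nat))) set" where
  "pi_shriek_rel L P n =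
     tensor_rel (ops L n) (act P n) (\<lambda>g \<tau>. perm L n g \<circ> \<tau>) (ops P n) (ops sym_operad n)"

definition pi_shriek_class ::
  "('g, 'm) action_operad_scheme \<Rightarrow> ('p, 'g, 'n) equiv_operad_scheme \<Rightarrow> nat
    \<Rightarrow> 'p \<Rightarrow> (nat \<Rightarrow> nat) \<Rightarrow> ('p \<times> (nat \<Rightarrow> nat)) set" where
  "pi_shriek_class L P n p \<tau> = pi_shriek_rel L P n `` {(p, \<tau>)}"

text \<open>
  Operations on classes are given by the union, over all choices of representatives, of the
  resulting classes; these classes all coincide when \<open>P\<close> is an equivariant operad over \<open>L\<close>.
\<close>

definition pi_shriek ::
  "('g, 'm) action_operad_scheme \<Rightarrow> ('p, 'g, 'n) equiv_operad_scheme
    \<Rightarrow> (('p \<times> (nat \<Rightarrow> nat)) set, nat \<Rightarrow> nat) equiv_operad" where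
  "pi_shriek L P =
     \<lparr>ops = (\<lambda>n. (ops P n \<times> ops sym_operad n) // pi_shriek_rel L P n),
      opid = pi_shriek_class L P 1 (opid P) (gone sym_operad 1),
      mu = (\<lambda>ks c cs. \<Union>{pi_shriek_class L P (sum_list ks)
                           (mu P (perm_tuple \<tau> ks) p (perm_tuple \<tau> (map fst rs)))
                           (mu sym_operad ks \<tau> (map snd rs))
                         | p \<tau> rs. (p, \<tau>) \<in> c \<and> list_all2 (\<in>) rs cs}),
      act = (\<lambda>n c \<sigma>. \<Union>{pi_shriek_class L P n p (\<tau> \<circ> \<sigma>) | p \<tau>. (p, \<tau>) \<in> c})\<rparr>"

end

(* An algebra structure is determined by the functions on P(n) x X^n that it induces; descending
   to the tensor product is the same as equivariance of the adjoint maps P(n) -> E_X(n), and the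
   algebra axioms are those of an operad map. A map f out of pi_! P is determined by its values
   on the classes [p, e], since [p, t] = [p, e].t, and p |-> f [p, e] is a map of Lambda-operads. *)
theory Submission
  imports Defs
begin

section \<open>Permuting tuples\<close>

text \<open>The second bijection needs \<open>mu\<close> on classes to be independent of
  representatives, and this is where identities between block permutations enter. They are not
  verified by index arithmetic: \<open>sigma_mu\<close> acts on a concatenation by permuting inside
  the blocks and then permuting the blocks, and a permutation of \<open>{..<n}\<close> is determined
  by its action on \<open>[0..<n]\<close>, so each identity reduces to one about lists. Inverses in
  the level groups turn the generated relation behind \<open>pi_shriek_rel\<close> into one given by
  a single group element. Two choices of representatives therefore differ by one element outside and
  one in each slot, and the equivariance axioms of \<open>P\<close> push these through
  \<open>mu\<close> as \<open>delta\<close> and \<open>beta\<close>.\<close>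

lemma length_perm_tuple [simp]: "length (perm_tuple \<sigma> xs) = length xs"
  by (simp add: perm_tuple_def)

lemma perm_tuple_id [simp]: "perm_tuple id xs = xs"
  by (simp add: perm_tuple_def permute_list_def map_nth)

lemma nth_perm_tuple:
  "i < length xs \<Longrightarrow> perm_tuple \<sigma> xs ! i = xs ! Hilbert_Choice.inv \<sigma> i"
  by (simp add: perm_tuple_def permute_list_def)

lemma permutes_lessThan_less:
  fixes n :: nat
  shows "\<lbrakk>\<sigma> permutes {..<n}; i < n\<rbrakk> \<Longrightarrow> \<sigma> i < n"
  using permutes_in_image[of \<sigma> "{..<n}" i] by simp

lemma inv_permutes_lessThan_less:
  fixes n :: nat
  shows "\<lbrakk>\<sigma> permutes {..<n}; i < n\<rbrakk> \<Longrightarrow> Hilbert_Choice.inv \<sigma> i < n"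
  by (simp add: permutes_inv permutes_lessThan_less)

lemma nth_perm_tuple_image:
  assumes "\<sigma> permutes {..<length xs}" "i < length xs"
  shows "perm_tuple \<sigma> xs ! \<sigma> i = xs ! i"
  using assms by (simp add: nth_perm_tuple permutes_lessThan_less permutes_inverses)

text \<open>Every position is \<open>\<sigma> i\<close> for exactly one \<open>i\<close>, so it
  suffices to follow each entry to where it goes. In this form no inverse has to be handled,
  although \<open>perm_tuple\<close> is defined by one.\<close>

lemma perm_tuple_eqI:
  assumes \<sigma>: "\<sigma> permutes {..<length xs}" and len: "length ys = length xs"
    and nth: "\<And>i. i < length xs \<Longrightarrow> ys ! \<sigma> i = xs ! i"
  shows "perm_tuple \<sigma> xs = ys"
proof (rule nth_equalityI)
  fix i assume "i < length (perm_tuple \<sigma> xs)"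
  then have i: "i < length xs" by simp
  show "perm_tuple \<sigma> xs ! i = ys ! i"
    using nth[of "Hilbert_Choice.inv \<sigma> i"] inv_permutes_lessThan_less[OF \<sigma> i] i
    by (simp add: nth_perm_tuple permutes_inverses[OF \<sigma>])
qed (simp add: len)

lemma perm_tuple_comp:
  assumes "\<sigma> permutes {..<length xs}" "\<tau> permutes {..<length xs}"
  shows "perm_tuple (\<sigma> \<circ> \<tau>) xs = perm_tuple \<sigma> (perm_tuple \<tau> xs)"
  by (rule perm_tuple_eqI)
    (use assms in \<open>auto simp: permutes_compose nth_perm_tuple_image permutes_lessThan_less\<close>)

text \<open>The entries of \<open>[0..<n]\<close> are distinct, so the permuted tuple records the
  whole permutation on \<open>{..<n}\<close>; elsewhere both permutations are the identity.\<close>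

lemma perm_tuple_faithful:
  assumes \<sigma>: "\<sigma> permutes {..<n}" and \<tau>: "\<tau> permutes {..<n}"
    and eq: "perm_tuple \<sigma> [0..<n] = perm_tuple \<tau> [0..<n]"
  shows "\<sigma> = \<tau>"
proof
  fix i
  show "\<sigma> i = \<tau> i"
  proof (cases "i < n")
    case True
    then have "perm_tuple \<tau> [0..<n] ! \<sigma> i = i"
      using nth_perm_tuple_image[of \<sigma> "[0..<n]" i] \<sigma> eq by simp
    then have "Hilbert_Choice.inv \<tau> (\<sigma> i) = i"
      using True permutes_lessThan_less[OF \<sigma> True] inv_permutes_lessThan_less[OF \<tau>]
      by (simp add: nth_perm_tuple)
    then show ?thesis
      by (metis permutes_inverses(1)[OF \<tau>])
  next
    case False
    then show ?thesis
      using \<sigma> \<tau> by (simp add: permutes_def)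
  qed
qed

lemma perm_tuple_map:
  assumes "\<sigma> permutes {..<length xs}"
  shows "perm_tuple \<sigma> (map f xs) = map f (perm_tuple \<sigma> xs)"
  by (rule perm_tuple_eqI)
    (use assms in \<open>auto simp: nth_perm_tuple_image permutes_lessThan_less\<close>)

lemma perm_tuple_map2:
  assumes "\<sigma> permutes {..<length xs}" "length xs = length ys"
  shows "perm_tuple \<sigma> (map2 f xs ys) = map2 f (perm_tuple \<sigma> xs) (perm_tuple \<sigma> ys)"
  by (rule perm_tuple_eqI)
    (use assms nth_perm_tuple_image[of \<sigma> ys] in
      \<open>auto simp: nth_perm_tuple_image permutes_lessThan_less\<close>)

lemma list_all2_perm_tuple:
  assumes "\<sigma> permutes {..<length xs}" "list_all2 R xs ys"
  shows "list_all2 R (perm_tuple \<sigma> xs) (perm_tuple \<sigma> ys)"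
  using assms inv_permutes_lessThan_less[OF assms(1)]
  by (auto simp: list_all2_conv_all_nth nth_perm_tuple)

lemma set_perm_tuple:
  assumes "\<sigma> permutes {..<length xs}"
  shows "set (perm_tuple \<sigma> xs) = set xs"
  using assms by (simp add: perm_tuple_def permutes_inv)

text \<open>Reordering the inputs of a composite keeps its total arity; this is what puts both sides
  of \<open>mu_act_left\<close> in the same level.\<close>

lemma sum_list_perm_tuple:
  fixes xs :: "nat list"
  assumes "\<sigma> permutes {..<length xs}"
  shows "sum_list (perm_tuple \<sigma> xs) = sum_list xs"
proof -
  have "mset (perm_tuple \<sigma> xs) = mset xs"
    using assms by (simp add: perm_tuple_def permutes_inv)
  then show ?thesis
    by (metis sum_mset_sum_list)
qed

lemma perm_tuple_tuples:
  assumes "\<sigma> permutes {..<n}" "xs \<in> tuples X n"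
  shows "perm_tuple \<sigma> xs \<in> tuples X n"
  using assms by (auto simp: tuples_def set_perm_tuple)

section \<open>Blocks and the multiplication of permutations\<close>

lemma block_start_Suc:
  "i < length ks \<Longrightarrow> block_start ks (Suc i) = block_start ks i + ks ! i"
  by (simp add: block_start_def take_Suc_conv_app_nth)

lemma block_start_mono: "i \<le> j \<Longrightarrow> block_start ks i \<le> block_start ks j"
  by (auto simp: block_start_def le_iff_add take_add)

lemma block_start_less:
  assumes "i < length ks" "a < ks ! i"
  shows "block_start ks i + a < sum_list ks"
proof -
  have "block_start ks (Suc i) \<le> block_start ks (length ks)"
    using assms by (intro block_start_mono) simp
  then show ?thesis
    using assms by (simp add: block_start_Suc) (simp add: block_start_def)
qed

text \<open>An earlier block, empty or not, ends at or before \<open>block_start ks i\<close>, so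
  the \<open>LEAST\<close> in \<open>block_index\<close> cannot stop before
  \<open>i\<close>.\<close>

lemma block_index_start:
  assumes "i < length ks" "a < ks ! i"
  shows "block_index ks (block_start ks i + a) = i"
  unfolding block_index_def
proof (rule Least_equality)
  fix j assume "block_start ks i + a < block_start ks (Suc j)"
  then show "i \<le> j"
    using block_start_mono[of "Suc j" i ks] by (cases "i \<le> j") auto
qed (use assms in \<open>simp add: block_start_Suc\<close>)

text \<open>With \<open>block_index_start\<close>, this makes pairs of a block and an offset into
  coordinates on the positions; empty blocks contribute none. The induction peels off the first
  block.\<close>

lemma block_position_cases:
  assumes "j < sum_list ks"
  obtains i a where "i < length ks" "a < ks ! i" "j = block_start ks i + a"
proof -
  have "\<exists>i a. i < length ks \<and> a < ks ! i \<and> j = block_start ks i + a"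
    using assms
  proof (induction ks arbitrary: j)
    case (Cons k ks)
    show ?case
    proof (cases "j < k")
      case True
      then have "0 < length (k # ks) \<and> j < (k # ks) ! 0 \<and> j = block_start (k # ks) 0 + j"
        by (simp add: block_start_def)
      then show ?thesis by blast
    next
      case False
      then have "j - k < sum_list ks"
        using Cons.prems by auto
      then obtain i a where "i < length ks" "a < ks ! i" "j - k = block_start ks i + a"
        using Cons.IH by blast
      then have "Suc i < length (k # ks) \<and> a < (k # ks) ! Suc i
          \<and> j = block_start (k # ks) (Suc i) + a"
        using False by (simp add: block_start_def)
      then show ?thesis by blast
    qed
  qed simp
  then show ?thesis using that by blast
qed

lemma nth_concat_block:
  assumes "i < length xss" "a < length (xss ! i)"
  shows "concat xss ! (block_start (map length xss) i + a) = xss ! i ! a"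
  using assms
proof (induction xss arbitrary: i)
  case (Cons xs xss)
  then show ?case
    by (cases i) (simp_all add: block_start_def nth_append add.assoc)
qed simp

text \<open>Identifies the sum in \<open>block_perm\<close>: at \<open>m = \<sigma> i\<close> it is
  the start of the block to which block \<open>i\<close> moves, measured in the permuted arities.
  Reindexing along \<open>\<sigma>\<close> turns target blocks into source blocks.\<close>

lemma block_start_perm_tuple:
  assumes \<sigma>: "\<sigma> permutes {..<length ks}" and m: "m \<le> length ks"
  shows "block_start (perm_tuple \<sigma> ks) m = (\<Sum>i | i < length ks \<and> \<sigma> i < m. ks ! i)"
proof -
  have "block_start (perm_tuple \<sigma> ks) m = (\<Sum>j<m. perm_tuple \<sigma> ks ! j)"
    using m by (simp add: block_start_def sum_list_sum_nth atLeast0LessThan)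
  also have "\<dots> = (\<Sum>i | i < length ks \<and> \<sigma> i < m. ks ! i)"
    by (rule sum.reindex_bij_witness[where i = \<sigma> and j = "Hilbert_Choice.inv \<sigma>"])
      (use m in \<open>auto simp: permutes_inverses[OF \<sigma>] nth_perm_tuple
        intro: inv_permutes_lessThan_less[OF \<sigma>]\<close>)
  finally show ?thesis .
qed

section \<open>The operad multiplication of the symmetric groups\<close>

abbreviation sigma_mu :: "nat list \<Rightarrow> (nat \<Rightarrow> nat) \<Rightarrow> (nat \<Rightarrow> nat) list \<Rightarrow> nat \<Rightarrow> nat" where
  "sigma_mu \<equiv> mu sym_operad"

lemma sym_operad_simps [simp]:
  "ops sym_operad n = {\<sigma>. \<sigma> permutes {..<n}}"
  "gone sym_operad n = id"
  "gmult sym_operad n \<sigma> \<tau> = \<sigma> \<circ> \<tau>"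
  by (simp_all add: sym_operad_def)

lemma op_tuple_sym_operad:
  "op_tuple sym_operad ks \<tau>s \<longleftrightarrow> list_all2 (\<lambda>k \<tau>. \<tau> permutes {..<k}) ks \<tau>s"
  by (simp add: op_tuple_def)

text \<open>In block coordinates the product sends \<open>(i, a)\<close> to
  \<open>(\<sigma> i, (\<tau>s ! i) a)\<close>, where the target coordinates refer to the permuted
  arity list.\<close>

lemma sigma_mu_block:
  assumes \<sigma>: "\<sigma> permutes {..<length ks}" and \<tau>s: "op_tuple sym_operad ks \<tau>s"
    and i: "i < length ks" and a: "a < ks ! i"
  shows "sigma_mu ks \<sigma> \<tau>s (block_start ks i + a)
    = block_start (perm_tuple \<sigma> ks) (\<sigma> i) + (\<tau>s ! i) a"
proof -
  \<comment> \<open>The inner permutation keeps the offset inside block \<open>i\<close>, so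
    \<open>block_perm\<close> finds the same block again.\<close>
  have b: "(\<tau>s ! i) a < ks ! i"
    using \<tau>s i a by (auto simp: op_tuple_sym_operad list_all2_conv_all_nth
        intro: permutes_lessThan_less)
  have "block_sum ks \<tau>s (block_start ks i + a) = block_start ks i + (\<tau>s ! i) a"
    using i a by (simp add: block_sum_def block_index_start block_start_less)
  moreover have "block_perm ks \<sigma> (block_start ks i + (\<tau>s ! i) a)
      = block_start (perm_tuple \<sigma> ks) (\<sigma> i) + (\<tau>s ! i) a"
    using i b permutes_lessThan_less[OF \<sigma> i]
    by (simp add: block_perm_def block_index_start block_start_less
        block_start_perm_tuple[OF \<sigma>])
  ultimately show ?thesis
    by (simp add: sym_operad_def)
qed

text \<open>Source and target coordinates determine each other, which gives injectivity;
  surjectivity is then automatic on a finite set.\<close>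

lemma sigma_mu_permutes:
  assumes \<sigma>: "\<sigma> permutes {..<length ks}" and \<tau>s: "op_tuple sym_operad ks \<tau>s"
  shows "sigma_mu ks \<sigma> \<tau>s permutes {..<sum_list ks}"
proof -
  let ?m = "sigma_mu ks \<sigma> \<tau>s" and ?ks = "perm_tuple \<sigma> ks"
  have \<tau>: "(\<tau>s ! i) permutes {..<ks ! i}" if "i < length ks" for i
    using \<tau>s that by (auto simp: op_tuple_sym_operad list_all2_conv_all_nth)
  have target: "\<sigma> i < length ?ks" "(\<tau>s ! i) a < ?ks ! \<sigma> i"
    if "i < length ks" "a < ks ! i" for i a
    using that \<sigma> \<tau> by (simp_all add: nth_perm_tuple_image permutes_lessThan_less)
  have maps: "?m j < sum_list ks" if j: "j < sum_list ks" for j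
  proof -
    obtain i a where ia: "i < length ks" "a < ks ! i" and "j = block_start ks i + a"
      using block_position_cases[OF j] .
    then show ?thesis
      using sigma_mu_block[OF \<sigma> \<tau>s ia] block_start_less[OF target[OF ia]]
      by (simp add: sum_list_perm_tuple[OF \<sigma>])
  qed
  have inj: "inj_on ?m {..<sum_list ks}"
  proof (rule inj_onI)
    fix j j' assume j: "j \<in> {..<sum_list ks}" "j' \<in> {..<sum_list ks}" and eq: "?m j = ?m j'"
    obtain i a where ia: "i < length ks" "a < ks ! i" and j1: "j = block_start ks i + a"
      using j(1) block_position_cases[of j ks] by auto
    obtain i' a' where ia': "i' < length ks" "a' < ks ! i'" and j2: "j' = block_start ks i' + a'"
      using j(2) block_position_cases[of j' ks] by auto
    have eq': "block_start ?ks (\<sigma> i) + (\<tau>s ! i) a = block_start ?ks (\<sigma> i') + (\<tau>s ! i') a'"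
      using eq sigma_mu_block[OF \<sigma> \<tau>s ia] sigma_mu_block[OF \<sigma> \<tau>s ia'] by (simp add: j1 j2)
    \<comment> \<open>Both sides are positions in the permuted arity list, so
      \<open>block_index\<close> reads off their block numbers.\<close>
    then have "\<sigma> i = \<sigma> i'"
      using block_index_start[OF target[OF ia]] block_index_start[OF target[OF ia']] by simp
    then have "i = i'"
      using permutes_inj[OF \<sigma>] by (simp add: inj_eq)
    moreover from this eq' have "a = a'"
      using permutes_inj[OF \<tau>[OF ia(1)]] by (simp add: inj_eq)
    ultimately show "j = j'" by (simp add: j1 j2)
  qed
  have "?m ` {..<sum_list ks} = {..<sum_list ks}"
    using maps by (intro endo_inj_surj inj) auto
  with inj have "bij_betw ?m {..<sum_list ks} {..<sum_list ks}"
    by (simp add: bij_betw_def)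
  \<comment> \<open>Beyond \<open>sum_list ks\<close> both \<open>block_sum\<close> and
    \<open>block_perm\<close> return their argument, which supplies the fixed points that
    \<open>permutes\<close> asks for.\<close>
  then show ?thesis
    by (rule bij_imp_permutes) (simp add: sym_operad_def block_sum_def block_perm_def)
qed

text \<open>
  Together with the faithfulness of the action on tuples, this equation yields all identities
  between block permutations that are needed.
\<close>

lemma perm_tuple_sigma_mu:
  assumes \<sigma>: "\<sigma> permutes {..<length xss}"
    and \<tau>s: "op_tuple sym_operad (map length xss) \<tau>s"
  shows "perm_tuple (sigma_mu (map length xss) \<sigma> \<tau>s) (concat xss)
    = concat (perm_tuple \<sigma> (map2 perm_tuple \<tau>s xss))"
proof (rule perm_tuple_eqI)
  let ?ks = "map length xss" and ?yss = "perm_tuple \<sigma> (map2 perm_tuple \<tau>s xss)"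
  have lt: "length \<tau>s = length xss"
    using \<tau>s by (auto simp: op_tuple_sym_operad dest: list_all2_lengthD)
  have \<tau>: "(\<tau>s ! i) permutes {..<length (xss ! i)}" if "i < length xss" for i
    using \<tau>s that by (auto simp: op_tuple_sym_operad list_all2_conv_all_nth)
  have yss: "?yss ! \<sigma> i = perm_tuple (\<tau>s ! i) (xss ! i)" if "i < length xss" for i
    using that lt \<sigma> by (subst nth_perm_tuple_image) auto
  \<comment> \<open>The blocks of the result have the permuted arities as lengths, so the target in
    \<open>sigma_mu_block\<close> is a block position of \<open>concat ?yss\<close>.\<close>
  have lens: "map length ?yss = perm_tuple \<sigma> ?ks"
  proof -
    have "map length (map2 perm_tuple \<tau>s xss) = ?ks"
      using lt by (intro nth_equalityI) auto
    then show ?thesis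
      using perm_tuple_map[of \<sigma> "map2 perm_tuple \<tau>s xss" length] \<sigma> lt by simp
  qed
  show "sigma_mu ?ks \<sigma> \<tau>s permutes {..<length (concat xss)}"
    using sigma_mu_permutes[OF _ \<tau>s] \<sigma> by (simp add: length_concat)
  show "length (concat ?yss) = length (concat xss)"
    using sum_list_perm_tuple[of \<sigma> ?ks] \<sigma> by (simp add: length_concat lens)
  fix j assume "j < length (concat xss)"
  then have "j < sum_list ?ks"
    by (simp add: length_concat)
  then obtain i a where i: "i < length ?ks" and a: "a < ?ks ! i"
    and j: "j = block_start ?ks i + a"
    by (rule block_position_cases)
  from i a have i': "i < length xss" and a': "a < length (xss ! i)" by simp_all
  have "concat ?yss ! sigma_mu ?ks \<sigma> \<tau>s j
      = concat ?yss ! (block_start (map length ?yss) (\<sigma> i) + (\<tau>s ! i) a)"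
    using sigma_mu_block[OF _ \<tau>s i a] \<sigma> by (simp add: j lens)
  also have "\<dots> = ?yss ! \<sigma> i ! (\<tau>s ! i) a"
    using i' a' lt yss[OF i'] permutes_lessThan_less[OF \<sigma> i']
      permutes_lessThan_less[OF \<tau>[OF i'] a']
    by (intro nth_concat_block) simp_all
  also have "\<dots> = concat xss ! j"
    using i' a' yss[OF i'] \<tau>[OF i']
    by (simp add: j nth_concat_block nth_perm_tuple_image)
  finally show "concat ?yss ! sigma_mu ?ks \<sigma> \<tau>s j = concat xss ! j" .
qed

section \<open>Cutting tuples into blocks; identities between block permutations\<close>

lemma concat_split_blocks [simp]:
  "length xs = sum_list ks \<Longrightarrow> concat (split_blocks ks xs) = xs"
  by (induction ks arbitrary: xs) auto

lemma length_split_blocks [simp]: "length (split_blocks ks xs) = length ks"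
  by (induction ks arbitrary: xs) auto

lemma map_length_split_blocks:
  "length xs = sum_list ks \<Longrightarrow> map length (split_blocks ks xs) = ks"
  by (induction ks arbitrary: xs) auto

lemma split_blocks_concat: "split_blocks (map length xss) (concat xss) = xss"
  by (induction xss) auto

text \<open>The test tuple is \<open>[0..<sum_list ks]\<close> cut into blocks: its concatenation
  has distinct entries, so \<open>perm_tuple_faithful\<close> applies. This is why
  \<open>xss\<close> has natural numbers as entries.\<close>

lemma sigma_mu_eqI:
  assumes \<rho>: "\<rho> permutes {..<sum_list ks}"
    and \<sigma>: "\<sigma> permutes {..<length ks}" and \<tau>s: "op_tuple sym_operad ks \<tau>s"
    and eq: "\<And>xss :: nat list list. map length xss = ks \<Longrightarrow>
      perm_tuple \<rho> (concat xss) = concat (perm_tuple \<sigma> (map2 perm_tuple \<tau>s xss))"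
  shows "\<rho> = sigma_mu ks \<sigma> \<tau>s"
proof (rule perm_tuple_faithful[OF \<rho> sigma_mu_permutes[OF \<sigma> \<tau>s]])
  let ?xss = "split_blocks ks [0..<sum_list ks]"
  have len: "map length ?xss = ks"
    by (simp add: map_length_split_blocks)
  show "perm_tuple \<rho> [0..<sum_list ks] = perm_tuple (sigma_mu ks \<sigma> \<tau>s) [0..<sum_list ks]"
    using eq[OF len] perm_tuple_sigma_mu[of \<sigma> ?xss \<tau>s] \<sigma> \<tau>s by (simp add: len)
qed

text \<open>Ensures that classes whose second component is the identity multiply to such a class
  again, so that \<open>p\<close> maps to \<open>[p, e]\<close> compatibly with
  \<open>mu\<close>.\<close>

lemma sigma_mu_id: "sigma_mu ks id (map (\<lambda>_. id) ks) = id"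
proof (rule sigma_mu_eqI[symmetric])
  fix xss :: "nat list list" assume "map length xss = ks"
  then have "map2 perm_tuple (map (\<lambda>_. id) ks) xss = xss"
    by (intro nth_equalityI) auto
  then show "perm_tuple id (concat xss)
      = concat (perm_tuple id (map2 perm_tuple (map (\<lambda>_. id) ks) xss))"
    by simp
qed (auto simp: op_tuple_sym_operad list_all2_conv_all_nth permutes_id)

text \<open>The law \<open>mu_mult\<close> for \<open>sym_operad\<close> itself, with the later
  inner permutations listed in the order of \<open>ks\<close> and then reordered by
  \<open>\<sigma>\<close>. Both sides act on a concatenation by the same inner permutations followed
  by the same permutation of blocks.\<close>

lemma sigma_mu_mult:
  assumes \<sigma>: "\<sigma> permutes {..<length ks}" and \<tau>s: "op_tuple sym_operad ks \<tau>s"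
    and \<sigma>': "\<sigma>' permutes {..<length ks}" and \<tau>s': "op_tuple sym_operad ks \<tau>s'"
  shows "sigma_mu (perm_tuple \<sigma> ks) \<sigma>' (perm_tuple \<sigma> \<tau>s') \<circ> sigma_mu ks \<sigma> \<tau>s
    = sigma_mu ks (\<sigma>' \<circ> \<sigma>) (map2 (\<circ>) \<tau>s' \<tau>s)"
proof (rule sigma_mu_eqI)
  have lt: "length \<tau>s = length ks" "length \<tau>s' = length ks"
    using \<tau>s \<tau>s' by (auto simp: op_tuple_sym_operad dest: list_all2_lengthD)
  have \<tau>s'': "op_tuple sym_operad (perm_tuple \<sigma> ks) (perm_tuple \<sigma> \<tau>s')"
    using \<tau>s' \<sigma> unfolding op_tuple_sym_operad by (intro list_all2_perm_tuple)
  show "sigma_mu (perm_tuple \<sigma> ks) \<sigma>' (perm_tuple \<sigma> \<tau>s') \<circ> sigma_mu ks \<sigma> \<tau>s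
      permutes {..<sum_list ks}"
    using sigma_mu_permutes[OF \<sigma> \<tau>s] sigma_mu_permutes[OF _ \<tau>s'', of \<sigma>'] \<sigma>'
    by (intro permutes_compose) (simp_all add: sum_list_perm_tuple[OF \<sigma>])
  show "\<sigma>' \<circ> \<sigma> permutes {..<length ks}"
    using \<sigma> \<sigma>' by (rule permutes_compose)
  show "op_tuple sym_operad ks (map2 (\<circ>) \<tau>s' \<tau>s)"
    using \<tau>s \<tau>s' by (auto simp: op_tuple_sym_operad list_all2_conv_all_nth permutes_compose)
  fix xss :: "nat list list" assume len: "map length xss = ks"
  then have lx: "length xss = length ks" by (metis length_map)
  let ?yss = "map2 perm_tuple \<tau>s xss"
  have leny: "map length ?yss = ks"
    unfolding len[symmetric] using lt lx by (intro nth_equalityI) simp_all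
  have leny': "map length (perm_tuple \<sigma> ?yss) = perm_tuple \<sigma> ks"
    using perm_tuple_map[of \<sigma> ?yss length] leny lt lx \<sigma> by simp
  have nth: "(\<tau>s ! i) permutes {..<length (xss ! i)}" "(\<tau>s' ! i) permutes {..<length (xss ! i)}"
    if "i < length ks" for i
    using \<tau>s \<tau>s' that len by (auto simp: op_tuple_sym_operad list_all2_conv_all_nth)
  have N: "sum_list ks = length (concat xss)"
    by (simp add: length_concat len)
  have "perm_tuple (sigma_mu (perm_tuple \<sigma> ks) \<sigma>' (perm_tuple \<sigma> \<tau>s') \<circ> sigma_mu ks \<sigma> \<tau>s) (concat xss)
      = perm_tuple (sigma_mu (perm_tuple \<sigma> ks) \<sigma>' (perm_tuple \<sigma> \<tau>s'))
          (perm_tuple (sigma_mu ks \<sigma> \<tau>s) (concat xss))"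
    using sigma_mu_permutes[OF \<sigma> \<tau>s] sigma_mu_permutes[OF _ \<tau>s'', of \<sigma>'] \<sigma>'
    by (intro perm_tuple_comp) (simp_all add: sum_list_perm_tuple[OF \<sigma>] N)
  also have "perm_tuple (sigma_mu ks \<sigma> \<tau>s) (concat xss) = concat (perm_tuple \<sigma> ?yss)"
    using perm_tuple_sigma_mu[of \<sigma> xss \<tau>s] \<sigma> \<tau>s lx by (simp add: len)
  also have "perm_tuple (sigma_mu (perm_tuple \<sigma> ks) \<sigma>' (perm_tuple \<sigma> \<tau>s')) \<dots>
      = concat (perm_tuple \<sigma>' (map2 perm_tuple (perm_tuple \<sigma> \<tau>s') (perm_tuple \<sigma> ?yss)))"
    using perm_tuple_sigma_mu[of \<sigma>' "perm_tuple \<sigma> ?yss" "perm_tuple \<sigma> \<tau>s'"] \<sigma>' \<tau>s'' lx lt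
    by (simp add: leny')
  \<comment> \<open>Permuting inside the slots commutes with reordering the slots, so all inner
    permutations come together before any block moves.\<close>
  also have "map2 perm_tuple (perm_tuple \<sigma> \<tau>s') (perm_tuple \<sigma> ?yss)
      = perm_tuple \<sigma> (map2 perm_tuple \<tau>s' ?yss)"
    using perm_tuple_map2[of \<sigma> \<tau>s' ?yss perm_tuple] \<sigma> lt lx by simp
  also have "perm_tuple \<sigma>' \<dots> = perm_tuple (\<sigma>' \<circ> \<sigma>) (map2 perm_tuple \<tau>s' ?yss)"
    using \<sigma> \<sigma>' lt lx by (simp add: perm_tuple_comp)
  also have "map2 perm_tuple \<tau>s' ?yss = map2 perm_tuple (map2 (\<circ>) \<tau>s' \<tau>s) xss"
    using lt lx nth by (intro nth_equalityI) (auto simp: perm_tuple_comp)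
  finally show "perm_tuple (sigma_mu (perm_tuple \<sigma> ks) \<sigma>' (perm_tuple \<sigma> \<tau>s') \<circ> sigma_mu ks \<sigma> \<tau>s)
      (concat xss) = concat (perm_tuple (\<sigma>' \<circ> \<sigma>) (map2 perm_tuple (map2 (\<circ>) \<tau>s' \<tau>s) xss))" .
qed

section \<open>Tensor products\<close>

text \<open>The closure of a symmetrised relation is symmetric and transitive. It is reflexive on
  the whole type, and the intersection cuts it down to an equivalence on the carrier.\<close>

lemma equiv_tensor_rel: "equiv (A \<times> B) (tensor_rel G ra la A B)"
proof (rule equivI)
  define R where "R = {((ra a g, b), (a, la g b)) | a g b. a \<in> A \<and> g \<in> G \<and> b \<in> B}"
  have rel: "tensor_rel G ra la A B = (R \<union> R\<inverse>)\<^sup>* \<inter> (A \<times> B) \<times> (A \<times> B)"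
    by (simp add: tensor_rel_def R_def Let_def)
  show "tensor_rel G ra la A B \<subseteq> (A \<times> B) \<times> (A \<times> B)"
    unfolding rel by blast
  show "refl_on (A \<times> B) (tensor_rel G ra la A B)"
    unfolding rel by (rule refl_onI) blast
  have "sym ((R \<union> R\<inverse>)\<^sup>*)"
    by (rule sym_rtrancl) (auto simp: sym_def)
  then show "sym (tensor_rel G ra la A B)"
    unfolding rel by (auto simp: sym_def)
  show "trans (tensor_rel G ra la A B)"
    unfolding rel by (rule transI) (blast intro: rtrancl_trans)
qed

text \<open>The universal property of the tensor product: a balanced function is constant along
  every zigzag of generating pairs.\<close>

lemma tensor_rel_respects:
  assumes uv: "(u, v) \<in> tensor_rel G ra la A B"
    and h: "\<And>a g b. \<lbrakk>a \<in> A; g \<in> G; b \<in> B\<rbrakk> \<Longrightarrow> h (ra a g, b) = h (a, la g b)"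
  shows "h u = h v"
proof -
  define R where "R = {((ra a g, b), (a, la g b)) | a g b. a \<in> A \<and> g \<in> G \<and> b \<in> B}"
  have "(u, v) \<in> (R \<union> R\<inverse>)\<^sup>*"
    using uv by (simp add: tensor_rel_def R_def Let_def)
  then show ?thesis
  proof induction
    case (step y z)
    then show ?case using h by (auto simp: R_def)
  qed simp
qed

lemma tensor_relI:
  assumes "a \<in> A" "g \<in> G" "b \<in> B" "ra a g \<in> A" "la g b \<in> B"
  shows "((ra a g, b), (a, la g b)) \<in> tensor_rel G ra la A B"
  using assms unfolding tensor_rel_def Let_def by blast

text \<open>The image is a singleton, so a function on a quotient written with
  \<open>the_elem\<close> can be evaluated at any representative.\<close>

lemma the_elem_image_class:
  assumes E: "equiv S E" and x: "x \<in> S" and h: "\<And>y. (x, y) \<in> E \<Longrightarrow> h x = h y"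
  shows "the_elem (h ` (E `` {x})) = h x"
proof (rule the_elem_image_unique)
  show "E `` {x} \<noteq> {}"
    using equiv_class_self[OF E x] by blast
qed (simp add: h)

section \<open>Level groups and their permutations\<close>

context action_operad
begin

lemma gone_closed: "gone L n \<in> ops L n"
  using group.is_monoid[OF level_group[of n]] monoid.one_closed[of "level_group L n"]
  by (simp add: level_group_def)

lemma gmult_closed: "\<lbrakk>g \<in> ops L n; h \<in> ops L n\<rbrakk> \<Longrightarrow> gmult L n g h \<in> ops L n"
  using group.is_monoid[OF level_group[of n]] monoid.m_closed[of "level_group L n" g h]
  by (simp add: level_group_def)

lemma ginv_ex:
  assumes "g \<in> ops L n"
  obtains h where "h \<in> ops L n" "gmult L n g h = gone L n"
proof -
  let ?G = "level_group L n"
  have "g \<in> carrier ?G"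
    using assms by (simp add: level_group_def)
  then have "m_inv ?G g \<in> carrier ?G" "g \<otimes>\<^bsub>?G\<^esub> m_inv ?G g = \<one>\<^bsub>?G\<^esub>"
    using group.inv_closed[OF level_group] group.r_inv[OF level_group] by auto
  then show ?thesis
    using that[of "m_inv ?G g"] by (simp add: level_group_def)
qed

lemma perm_permutes: "g \<in> ops L n \<Longrightarrow> perm L n g permutes {..<n}"
  using perm_operad_hom by (auto simp: operad_hom_def)

lemma perm_gmult:
  "\<lbrakk>g \<in> ops L n; h \<in> ops L n\<rbrakk> \<Longrightarrow> perm L n (gmult L n g h) = perm L n g \<circ> perm L n h"
  using hom_mult[OF perm_group_hom[of n], of g h] by (simp add: level_group_def)

text \<open>The unit is idempotent, hence so is its permutation, and an injective idempotent map is
  the identity.\<close>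

lemma perm_gone [simp]: "perm L n (gone L n) = id"
proof -
  let ?e = "perm L n (gone L n)"
  have "gmult L n (gone L n) (gone L n) = gone L n"
    using group.is_monoid[OF level_group[of n]] monoid.l_one[of "level_group L n" "gone L n"]
      gone_closed[of n]
    by (simp add: level_group_def)
  then have e: "?e \<circ> ?e = ?e"
    using perm_gmult[OF gone_closed gone_closed, of n] by simp
  have "inj ?e"
    using permutes_inj[OF perm_permutes[OF gone_closed]] .
  then show ?thesis
    using e by (auto simp: fun_eq_iff inj_eq)
qed

lemma perm_mu:
  "\<lbrakk>g \<in> ops L (length ks); op_tuple L ks fs\<rbrakk>
    \<Longrightarrow> perm L (sum_list ks) (mu L ks g fs)
      = sigma_mu ks (perm L (length ks) g) (map2 (perm L) ks fs)"
  using perm_operad_hom by (simp add: operad_hom_def)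

lemma op_tuple_perm: "op_tuple L ks gs \<Longrightarrow> op_tuple sym_operad ks (map2 (perm L) ks gs)"
  by (auto simp: op_tuple_def list_all2_conv_all_nth perm_permutes)

lemma op_tuple_gone: "op_tuple L ks (map (gone L) ks)"
  by (auto simp: op_tuple_def list_all2_conv_all_nth gone_closed)

end

section \<open>The operad \<open>\<pi>\<^sub>!P\<close>\<close>

lemma op_tuple_perm_tuple:
  "\<lbrakk>\<sigma> permutes {..<length ks}; op_tuple A ks qs\<rbrakk>
    \<Longrightarrow> op_tuple A (perm_tuple \<sigma> ks) (perm_tuple \<sigma> qs)"
  unfolding op_tuple_def by (rule list_all2_perm_tuple)

lemma op_tuple_length: "op_tuple A ks qs \<Longrightarrow> length qs = length ks"
  by (auto simp: op_tuple_def dest: list_all2_lengthD)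

lemma op_tuple_nth: "\<lbrakk>op_tuple A ks qs; i < length ks\<rbrakk> \<Longrightarrow> qs ! i \<in> ops A (ks ! i)"
  by (auto simp: op_tuple_def list_all2_conv_all_nth)

lemma op_tuple_mapI:
  "\<lbrakk>\<And>i. i < length ks \<Longrightarrow> h i \<in> ops A (ks ! i)\<rbrakk> \<Longrightarrow> op_tuple A ks (map h [0..<length ks])"
  by (auto simp: op_tuple_def list_all2_conv_all_nth)

lemma op_tuple_id: "op_tuple sym_operad ks (map (\<lambda>_. id) ks)"
  by (auto simp: op_tuple_def list_all2_conv_all_nth permutes_id)

lemma pi_star_simps [simp]:
  "ops (pi_star L Q) = ops Q" "opid (pi_star L Q) = opid Q" "mu (pi_star L Q) = mu Q"
  "act (pi_star L Q) n q g = act Q n q (perm L n g)"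
  by (simp_all add: pi_star_def)

context equivariant_operad
begin

text \<open>
  Since \<open>\<Lambda>(n)\<close> is a group, the generating relation is already an equivalence relation, so any two
  equivalent pairs are related by a single group element.
\<close>

lemma pi_shriek_relD:
  assumes "((p, \<tau>), (p', \<tau>')) \<in> pi_shriek_rel L P n"
  shows "p' \<in> ops P n" "\<tau>' permutes {..<n}"
    "\<exists>g \<in> ops L n. p = act P n p' g \<and> \<tau>' = perm L n g \<circ> \<tau>"
proof -
  define A where "A = ops P n \<times> {\<tau> :: nat \<Rightarrow> nat. \<tau> permutes {..<n}}"
  define S where "S = {((act P n p g, \<tau>), (p, perm L n g \<circ> \<tau>)) | p g \<tau>.
    p \<in> ops P n \<and> g \<in> ops L n \<and> \<tau> permutes {..<n}}"
  have S_refl: "(u, u) \<in> S" if u: "u \<in> A" for u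
  proof -
    obtain p \<tau> where "u = (p, \<tau>)" "p \<in> ops P n" "\<tau> permutes {..<n}"
      using u by (auto simp: A_def)
    moreover from this have "u = (act P n p (gone L n), \<tau>)" "u = (p, perm L n (gone L n) \<circ> \<tau>)"
      by (simp_all add: act_one)
    ultimately show ?thesis
      using L.gone_closed unfolding S_def by blast
  qed
  have S_trans: "(u, w) \<in> S" if uv: "(u, v) \<in> S" and vw: "(v, w) \<in> S" for u v w
  proof -
    obtain p g \<tau> where 1: "u = (act P n p g, \<tau>)" "v = (p, perm L n g \<circ> \<tau>)"
      "g \<in> ops L n" "\<tau> permutes {..<n}"
      using uv unfolding S_def by blast
    obtain p' g' where 2: "p = act P n p' g'" "w = (p', perm L n g' \<circ> (perm L n g \<circ> \<tau>))"
      "p' \<in> ops P n" "g' \<in> ops L n"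
      using vw 1(2) unfolding S_def by blast
    \<comment> \<open>Two steps compose to the step given by \<open>g' g\<close>, in this order
      because the action on \<open>P\<close> is from the right.\<close>
    have "u = (act P n p' (gmult L n g' g), \<tau>)" "w = (p', perm L n (gmult L n g' g) \<circ> \<tau>)"
      using 1 2 by (simp_all add: act_mult L.perm_gmult comp_assoc)
    then show ?thesis
      using 1 2 L.gmult_closed unfolding S_def by blast
  qed
  have S_inverse: "(v, u) \<in> S" if uv: "(u, v) \<in> S" for u v
  proof -
    obtain p g \<tau> where 1: "u = (act P n p g, \<tau>)" "v = (p, perm L n g \<circ> \<tau>)"
      "p \<in> ops P n" "g \<in> ops L n" "\<tau> permutes {..<n}"
      using uv unfolding S_def by blast
    obtain h where h: "h \<in> ops L n" "gmult L n g h = gone L n"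
      using L.ginv_ex[OF 1(4)] .
    have gh: "perm L n g \<circ> perm L n h = id"
      using L.perm_gmult[OF 1(4) h(1)] by (simp add: h)
    \<comment> \<open>The chosen \<open>h\<close> is a right inverse; injectivity of the permutation
      of \<open>g\<close> makes its permutation a left inverse too.\<close>
    have "perm L n h (perm L n g x) = x" for x
      using gh permutes_inj[OF L.perm_permutes[OF 1(4)]] by (metis comp_apply id_apply injD)
    then have "perm L n h \<circ> perm L n g = id"
      by (simp add: fun_eq_iff)
    then have "u = (act P n p g, perm L n h \<circ> (perm L n g \<circ> \<tau>))"
      using 1 by (simp flip: comp_assoc)
    moreover have "v = (act P n (act P n p g) h, perm L n g \<circ> \<tau>)"
      using 1 h act_mult[of p n g h] by (simp add: act_one)
    moreover have "perm L n g \<circ> \<tau> permutes {..<n}"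
      using 1 by (intro permutes_compose L.perm_permutes)
    ultimately show ?thesis
      using act_closed[OF 1(3,4)] h(1) unfolding S_def by blast
  qed
  have rel: "pi_shriek_rel L P n = (S \<union> S\<inverse>)\<^sup>* \<inter> A \<times> A"
    by (simp add: pi_shriek_rel_def tensor_rel_def S_def A_def Let_def)
  \<comment> \<open>\<open>S\<close> is already reflexive on the carrier, symmetric and transitive,
    so a zigzag of any length collapses to a single step.\<close>
  have "(u, v) \<in> S" if "(u, v) \<in> (S \<union> S\<inverse>)\<^sup>*" "u \<in> A" for u v
    using that
  proof induction
    case (step y z)
    then have "(y, z) \<in> S"
      using S_inverse by blast
    then show ?case using step S_trans by blast
  qed (rule S_refl)
  then have "((p, \<tau>), (p', \<tau>')) \<in> S"
    using assms by (auto simp: rel)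
  then show "\<exists>g \<in> ops L n. p = act P n p' g \<and> \<tau>' = perm L n g \<circ> \<tau>"
    unfolding S_def by blast
  show "p' \<in> ops P n" "\<tau>' permutes {..<n}"
    using assms by (auto simp: rel A_def)
qed

section \<open>Classes in \<open>pi_shriek L P\<close> and the operations on them\<close>

lemma equiv_pi_shriek_rel:
  "equiv (ops P n \<times> {\<tau>. \<tau> permutes {..<n}}) (pi_shriek_rel L P n)"
  using equiv_tensor_rel[of "ops P n" "ops sym_operad n"] by (simp add: pi_shriek_rel_def)

lemma ops_pi_shriek:
  "ops (pi_shriek L P) n = (ops P n \<times> {\<tau>. \<tau> permutes {..<n}}) // pi_shriek_rel L P n"
  by (simp add: pi_shriek_def)

lemma pi_shriek_class_closed:
  "\<lbrakk>p \<in> ops P n; \<tau> permutes {..<n}\<rbrakk> \<Longrightarrow> pi_shriek_class L P n p \<tau> \<in> ops (pi_shriek L P) n"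
  unfolding ops_pi_shriek pi_shriek_class_def by (rule quotientI) simp

lemma pi_shriek_cases:
  assumes "c \<in> ops (pi_shriek L P) n"
  obtains p \<tau> where "p \<in> ops P n" "\<tau> permutes {..<n}" "c = pi_shriek_class L P n p \<tau>"
  using assms unfolding ops_pi_shriek pi_shriek_class_def by (auto elim!: quotientE)

lemma pi_shriek_class_self:
  "\<lbrakk>p \<in> ops P n; \<tau> permutes {..<n}\<rbrakk> \<Longrightarrow> (p, \<tau>) \<in> pi_shriek_class L P n p \<tau>"
  unfolding pi_shriek_class_def by (rule equiv_class_self[OF equiv_pi_shriek_rel]) simp

lemma pi_shriek_class_act:
  assumes "p \<in> ops P n" "g \<in> ops L n" "\<tau> permutes {..<n}"
  shows "pi_shriek_class L P n (act P n p g) \<tau> = pi_shriek_class L P n p (perm L n g \<circ> \<tau>)"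
  unfolding pi_shriek_class_def
proof (rule equiv_class_eq[OF equiv_pi_shriek_rel])
  have "perm L n g \<circ> \<tau> permutes {..<n}"
    using assms by (intro permutes_compose L.perm_permutes)
  then show "((act P n p g, \<tau>), (p, perm L n g \<circ> \<tau>)) \<in> pi_shriek_rel L P n"
    unfolding pi_shriek_rel_def using assms
    by (intro tensor_relI[where la = "\<lambda>g \<tau>. perm L n g \<circ> \<tau>"] act_closed) simp_all
qed

lemma mem_pi_shriek_classD:
  assumes "(p', \<tau>') \<in> pi_shriek_class L P n p \<tau>"
  shows "p' \<in> ops P n" "\<tau>' permutes {..<n}"
    "\<exists>g \<in> ops L n. p = act P n p' g \<and> \<tau>' = perm L n g \<circ> \<tau>"
  using pi_shriek_relD assms by (simp_all add: pi_shriek_class_def)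

text \<open>The axioms of \<open>P\<close> extract \<open>g\<close> and the inner elements from the
  product as \<open>delta\<close> and \<open>beta\<close>. The tensor relation moves both to the
  second component, where \<open>perm L\<close> turns them into block permutations and
  \<open>sigma_mu_mult\<close> absorbs them.\<close>

lemma pi_shriek_mu_well_defined:
  assumes p: "p \<in> ops P (length ks)" and g: "g \<in> ops L (length ks)"
    and \<tau>: "\<tau> permutes {..<length ks}"
    and qs: "op_tuple P ks qs" and gs: "op_tuple L ks gs" and \<tau>s: "op_tuple sym_operad ks \<tau>s"
  shows "pi_shriek_class L P (sum_list ks)
      (mu P (perm_tuple \<tau> ks) (act P (length ks) p g)
        (perm_tuple \<tau> (map (\<lambda>i. act P (ks ! i) (qs ! i) (gs ! i)) [0..<length ks])))
      (sigma_mu ks \<tau> \<tau>s)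
    = pi_shriek_class L P (sum_list ks)
      (mu P (perm_tuple (perm L (length ks) g \<circ> \<tau>) ks) p
        (perm_tuple (perm L (length ks) g \<circ> \<tau>) qs))
      (sigma_mu ks (perm L (length ks) g \<circ> \<tau>) (map2 (\<circ>) (map2 (perm L) ks gs) \<tau>s))"
proof -
  define n ks' qs' gs' \<sigma> where "n = length ks" and "ks' = perm_tuple \<tau> ks"
    and "qs' = perm_tuple \<tau> qs" and "gs' = perm_tuple \<tau> gs" and "\<sigma> = perm L n g"
  note defs = n_def ks'_def qs'_def gs'_def \<sigma>_def
  let ?N = "sum_list ks" and ?\<tau>s = "map2 (\<circ>) (map2 (perm L) ks gs) \<tau>s"
  have len: "length ks' = n" "length qs = n" "length gs = n" "length \<tau>s = n"
    using qs gs \<tau>s by (simp_all add: defs op_tuple_length)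
  have N: "sum_list ks' = ?N"
    using \<tau> by (simp add: defs sum_list_perm_tuple)
  have \<sigma>: "\<sigma> permutes {..<n}"
    using g by (simp add: defs L.perm_permutes)
  have tup: "op_tuple P ks' qs'" "op_tuple L ks' gs'"
    using \<tau> qs gs by (simp_all add: defs op_tuple_perm_tuple)
  have tup\<sigma>: "op_tuple P (perm_tuple \<sigma> ks') (perm_tuple \<sigma> qs')"
    using \<sigma> tup len by (simp add: op_tuple_perm_tuple)
  have N\<sigma>: "sum_list (perm_tuple \<sigma> ks') = ?N"
    using \<sigma> len N by (simp add: sum_list_perm_tuple)
  let ?q = "mu P (perm_tuple \<sigma> ks') p (perm_tuple \<sigma> qs')"
  have q: "?q \<in> ops P ?N"
    using mu_closed[of p, OF _ tup\<sigma>] p len N\<sigma> by (simp add: n_def)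
  have beta: "beta L ks' gs' \<in> ops L ?N" and delta: "delta L ks' g \<in> ops L ?N"
    using L.mu_closed[of "gone L n", OF _ tup(2)] L.mu_closed[of g, OF _ L.op_tuple_gone[of ks']]
      L.gone_closed[of n] g len N by (simp_all add: beta_def delta_def n_def)
  have \<tau>s2: "op_tuple sym_operad ks (map2 (perm L) ks gs)"
    using gs by (rule L.op_tuple_perm)
  have \<tau>s3: "op_tuple sym_operad ks ?\<tau>s"
    using \<tau>s \<tau>s2 by (auto simp: op_tuple_sym_operad list_all2_conv_all_nth permutes_compose)
  \<comment> \<open>Acting slot by slot commutes with reordering, which brings the product into the
    form of \<open>mu_act_right\<close> for the reordered arities.\<close>
  have "perm_tuple \<tau> (map (\<lambda>i. act P (ks ! i) (qs ! i) (gs ! i)) [0..<n])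
      = map (\<lambda>i. act P (ks' ! i) (qs' ! i) (gs' ! i)) [0..<n]"
    using \<tau> len by (intro nth_equalityI)
      (simp_all add: defs nth_perm_tuple inv_permutes_lessThan_less)
  then have "mu P ks' (act P n p g)
        (perm_tuple \<tau> (map (\<lambda>i. act P (ks ! i) (qs ! i) (gs ! i)) [0..<n]))
      = act P ?N (mu P ks' (act P n p g) qs') (beta L ks' gs')"
    using mu_act_right[OF len(1) act_closed tup] p g N by (simp add: n_def)
  also have "mu P ks' (act P n p g) qs' = act P ?N ?q (delta L ks' g)"
    using mu_act_left[OF len(1) _ tup(1)] p g N by (simp add: \<sigma>_def n_def)
  \<comment> \<open>The outermost factor \<open>beta\<close> is moved across first, then
    \<open>delta\<close>, so \<open>delta\<close> ends up leftmost among the permutations.\<close>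
  finally have "pi_shriek_class L P ?N (mu P ks' (act P n p g)
        (perm_tuple \<tau> (map (\<lambda>i. act P (ks ! i) (qs ! i) (gs ! i)) [0..<n]))) (sigma_mu ks \<tau> \<tau>s)
      = pi_shriek_class L P ?N ?q
        (perm L ?N (delta L ks' g) \<circ> (perm L ?N (beta L ks' gs') \<circ> sigma_mu ks \<tau> \<tau>s))"
    using q beta delta sigma_mu_permutes[OF \<tau> \<tau>s]
    by (simp add: pi_shriek_class_act act_closed permutes_compose L.perm_permutes)
  also have "perm L ?N (beta L ks' gs') = sigma_mu ks' id (perm_tuple \<tau> (map2 (perm L) ks gs))"
    using L.perm_mu[OF _ tup(2), of "gone L n"] L.gone_closed[of n] N len \<tau>
    by (simp add: beta_def) (simp add: defs perm_tuple_map2)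
  \<comment> \<open>The image of \<open>beta\<close> has outer permutation \<open>id\<close>, so it
    changes only the inner permutations.\<close>
  also have "\<dots> \<circ> sigma_mu ks \<tau> \<tau>s = sigma_mu ks \<tau> ?\<tau>s"
    using sigma_mu_mult[OF \<tau> \<tau>s permutes_id \<tau>s2] by (simp add: ks'_def)
  also have "perm L ?N (delta L ks' g) = sigma_mu ks' \<sigma> (perm_tuple \<tau> (map (\<lambda>_. id) ks))"
  proof -
    have "map2 (perm L) ks' (map (gone L) ks') = map (\<lambda>_. id) ks'"
      by (intro nth_equalityI) simp_all
    also have "\<dots> = perm_tuple \<tau> (map (\<lambda>_. id) ks)"
      using \<tau> by (simp add: ks'_def perm_tuple_map)
    finally show ?thesis
      using L.perm_mu[OF _ L.op_tuple_gone[of ks'], of g] g N len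
      by (simp add: delta_def \<sigma>_def n_def)
  qed
  \<comment> \<open>The image of \<open>delta\<close> has inner permutations \<open>id\<close>, so
    it changes only the outer permutation.\<close>
  also have "\<dots> \<circ> sigma_mu ks \<tau> ?\<tau>s = sigma_mu ks (\<sigma> \<circ> \<tau>) ?\<tau>s"
  proof -
    have "map2 (\<circ>) (map (\<lambda>_. id) ks) ?\<tau>s = ?\<tau>s"
      using len by (intro nth_equalityI) (simp_all add: n_def)
    then show ?thesis
      using sigma_mu_mult[OF \<tau> \<tau>s3 _ op_tuple_id[of ks], of \<sigma>] \<sigma> by (simp add: ks'_def n_def)
  qed
  also have "?q = mu P (perm_tuple (\<sigma> \<circ> \<tau>) ks) p (perm_tuple (\<sigma> \<circ> \<tau>) qs)"
    using \<sigma> \<tau> len by (simp add: ks'_def qs'_def n_def perm_tuple_comp)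
  finally show ?thesis
    by (simp only: defs)
qed

text \<open>Every choice of representatives yields the same class, so the union defining
  \<open>mu\<close> is a union over a single set.\<close>

lemma pi_shriek_mu_class:
  assumes p: "p \<in> ops P (length ks)" and \<tau>: "\<tau> permutes {..<length ks}"
    and qs: "op_tuple P ks qs" and \<tau>s: "op_tuple sym_operad ks \<tau>s"
  shows "mu (pi_shriek L P) ks (pi_shriek_class L P (length ks) p \<tau>)
      (map (\<lambda>i. pi_shriek_class L P (ks ! i) (qs ! i) (\<tau>s ! i)) [0..<length ks])
    = pi_shriek_class L P (sum_list ks) (mu P (perm_tuple \<tau> ks) p (perm_tuple \<tau> qs))
        (sigma_mu ks \<tau> \<tau>s)"
    (is "mu _ _ ?c ?cs = ?r")
proof -
  let ?res = "\<lambda>p \<tau> rs. pi_shriek_class L P (sum_list ks)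
    (mu P (perm_tuple \<tau> ks) p (perm_tuple \<tau> (map fst rs))) (sigma_mu ks \<tau> (map snd rs))"
  have len: "length qs = length ks" "length \<tau>s = length ks"
    using qs \<tau>s by (simp_all add: op_tuple_length)
  have \<tau>s_nth: "(\<tau>s ! i) permutes {..<ks ! i}" if "i < length ks" for i
    using op_tuple_nth[OF \<tau>s that] by simp
  have unique: "?res p' \<tau>' rs = ?r"
    if c: "(p', \<tau>') \<in> ?c" and cs: "list_all2 (\<in>) rs ?cs" for p' \<tau>' rs
  proof -
    obtain g where g: "g \<in> ops L (length ks)" "p = act P (length ks) p' g"
      "\<tau>' = perm L (length ks) g \<circ> \<tau>"
      using mem_pi_shriek_classD(3)[OF c] by blast
    have lrs: "length rs = length ks"
      using list_all2_lengthD[OF cs] by simp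
    have mem: "(fst (rs ! i), snd (rs ! i)) \<in> pi_shriek_class L P (ks ! i) (qs ! i) (\<tau>s ! i)"
      if "i < length ks" for i
      using list_all2_nthD[OF cs, of i] that lrs by simp
    then have "\<forall>i. i < length ks \<longrightarrow> (\<exists>h \<in> ops L (ks ! i).
        qs ! i = act P (ks ! i) (fst (rs ! i)) h \<and> snd (rs ! i) = perm L (ks ! i) h \<circ> \<tau>s ! i)"
      using mem_pi_shriek_classD(3) by blast
    then obtain h where h: "\<And>i. i < length ks \<Longrightarrow> h i \<in> ops L (ks ! i)
        \<and> qs ! i = act P (ks ! i) (fst (rs ! i)) (h i)
        \<and> snd (rs ! i) = perm L (ks ! i) (h i) \<circ> \<tau>s ! i"
      by metis
    define gs where "gs = map h [0..<length ks]"
    have gs: "op_tuple L ks gs"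
      unfolding gs_def using h by (intro op_tuple_mapI) blast
    have fst_rs: "op_tuple P ks (map fst rs)"
      using mem_pi_shriek_classD(1)[OF mem] lrs by (auto simp: op_tuple_def list_all2_conv_all_nth)
    have "map (\<lambda>i. act P (ks ! i) (map fst rs ! i) (gs ! i)) [0..<length ks] = qs"
      using len lrs h by (intro nth_equalityI) (simp_all add: gs_def)
    moreover have "map2 (\<circ>) (map2 (perm L) ks gs) \<tau>s = map snd rs"
      using len lrs h by (intro nth_equalityI) (simp_all add: gs_def)
    \<comment> \<open>The given \<open>p\<close> and \<open>qs\<close> are the chosen
      representatives moved by \<open>g\<close> and \<open>gs\<close>. So the left side of
      \<open>pi_shriek_mu_well_defined\<close> is the fixed class \<open>?r\<close>, and its right
      side is the class of the arbitrary choice.\<close>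
    ultimately show ?thesis
      using pi_shriek_mu_well_defined[OF mem_pi_shriek_classD(1)[OF c] g(1) \<tau> fst_rs gs \<tau>s]
      by (simp flip: g(2,3))
  qed
  \<comment> \<open>The given data are themselves a valid choice, so the family of classes is not
    empty.\<close>
  have "(p, \<tau>) \<in> ?c" and cs: "list_all2 (\<in>) (zip qs \<tau>s) ?cs"
    using p \<tau> qs \<tau>s_nth len
    by (auto simp: pi_shriek_class_self list_all2_conv_all_nth op_tuple_nth)
  then have "{?res p \<tau> rs | p \<tau> rs. (p, \<tau>) \<in> ?c \<and> list_all2 (\<in>) rs ?cs} = {?r}"
    using unique by fast
  then show ?thesis
    by (simp add: pi_shriek_def)
qed

text \<open>Right multiplication by \<open>\<sigma>\<close> commutes with the left multiplication by
  \<open>perm L n g\<close> that relates two representatives, so all classes in the union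
  agree.\<close>

lemma pi_shriek_act_class:
  assumes p: "p \<in> ops P n" and \<tau>: "\<tau> permutes {..<n}" and \<sigma>: "\<sigma> permutes {..<n}"
  shows "act (pi_shriek L P) n (pi_shriek_class L P n p \<tau>) \<sigma> = pi_shriek_class L P n p (\<tau> \<circ> \<sigma>)"
proof -
  have "pi_shriek_class L P n p' (\<tau>' \<circ> \<sigma>) = pi_shriek_class L P n p (\<tau> \<circ> \<sigma>)"
    if c: "(p', \<tau>') \<in> pi_shriek_class L P n p \<tau>" for p' \<tau>'
  proof -
    obtain g where g: "g \<in> ops L n" "p = act P n p' g" "\<tau>' = perm L n g \<circ> \<tau>"
      using mem_pi_shriek_classD(3)[OF c] by blast
    then show ?thesis
      using pi_shriek_class_act[OF mem_pi_shriek_classD(1)[OF c] g(1) permutes_compose[OF \<sigma> \<tau>]]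
      by (simp add: comp_assoc)
  qed
  then have "{pi_shriek_class L P n p' (\<tau>' \<circ> \<sigma>) | p' \<tau>'. (p', \<tau>') \<in> pi_shriek_class L P n p \<tau>}
      = {pi_shriek_class L P n p (\<tau> \<circ> \<sigma>)}"
    using pi_shriek_class_self[OF p \<tau>] by fast
  then show ?thesis
    by (simp add: pi_shriek_def)
qed

lemma op_tuple_pi_shriek_cases:
  assumes "op_tuple (pi_shriek L P) ks cs"
  obtains qs \<tau>s where "op_tuple P ks qs" "op_tuple sym_operad ks \<tau>s"
    "cs = map (\<lambda>i. pi_shriek_class L P (ks ! i) (qs ! i) (\<tau>s ! i)) [0..<length ks]"
proof -
  have "\<forall>i. i < length ks \<longrightarrow> (\<exists>q \<tau>. q \<in> ops P (ks ! i) \<and> \<tau> permutes {..<ks ! i}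
      \<and> cs ! i = pi_shriek_class L P (ks ! i) q \<tau>)"
    using op_tuple_nth[OF assms] by (meson pi_shriek_cases)
  then obtain q \<tau> where *: "\<And>i. i < length ks \<Longrightarrow> q i \<in> ops P (ks ! i)
      \<and> \<tau> i permutes {..<ks ! i} \<and> cs ! i = pi_shriek_class L P (ks ! i) (q i) (\<tau> i)"
    by metis
  show ?thesis
  proof
    show "op_tuple P ks (map q [0..<length ks])" "op_tuple sym_operad ks (map \<tau> [0..<length ks])"
      using * by (auto intro!: op_tuple_mapI)
    show "cs = map (\<lambda>i. pi_shriek_class L P (ks ! i) (map q [0..<length ks] ! i)
        (map \<tau> [0..<length ks] ! i)) [0..<length ks]"
      using * op_tuple_length[OF assms] by (intro nth_equalityI) simp_all
  qed
qed

end

section \<open>The two bijections\<close>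

lemma end_operad_simps [simp]:
  "ops (end_operad X) n = tuples X n \<rightarrow>\<^sub>E X"
  "opid (end_operad X) = (\<lambda>xs \<in> tuples X 1. hd xs)"
  "mu (end_operad X) ks f hs = (\<lambda>xs \<in> tuples X (sum_list ks).
      f (map2 (\<lambda>h ys. h ys) hs (split_blocks ks xs)))"
  "act (end_operad X) n f \<sigma> = (\<lambda>xs \<in> tuples X n. f (perm_tuple \<sigma> xs))"
  by (simp_all add: end_operad_def)

lemma tuples_split_blocks:
  "xs \<in> tuples X (sum_list ks) \<Longrightarrow> list_all2 (\<lambda>k ys. ys \<in> tuples X k) ks (split_blocks ks xs)"
proof (induction ks arbitrary: xs)
  case (Cons k ks)
  then have "take k xs \<in> tuples X k" "drop k xs \<in> tuples X (sum_list ks)"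
    by (auto simp: tuples_def dest: in_set_takeD in_set_dropD)
  then show ?case
    using Cons.IH by simp
qed simp

lemma tuples_concat:
  "list_all2 (\<lambda>k ys. ys \<in> tuples X k) ks xss
    \<Longrightarrow> map length xss = ks \<and> concat xss \<in> tuples X (sum_list ks)"
  by (induction rule: list_all2_induct) (auto simp: tuples_def)

lemma tuples_one_cases:
  assumes "xs \<in> tuples X (Suc 0)"
  obtains x where "x \<in> X" "xs = [x]"
  using assms by (auto simp: tuples_def length_Suc_conv)

section \<open>Passing between algebra structures and operad maps\<close>

definition alg_to_map ::
  "('g, 'm) action_operad_scheme \<Rightarrow> ('p, 'g, 'n) equiv_operad_scheme \<Rightarrow> 'x set
    \<Rightarrow> (nat \<Rightarrow> ('p \<times> 'x list) set \<Rightarrow> 'x) \<Rightarrow> nat \<Rightarrow> 'p \<Rightarrow> 'x list \<Rightarrow> 'x" where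
  "alg_to_map L P X \<alpha> n = (\<lambda>p \<in> ops P n. \<lambda>xs \<in> tuples X n. alg_tilde L P X \<alpha> n p xs)"

text \<open>An equivariant family is constant on each class, so \<open>the_elem\<close> picks the
  common value. The restriction to \<open>alg_tensor\<close> matches the extensionality demanded in
  \<open>algebra_structures\<close>.\<close>

definition map_to_alg ::
  "('g, 'm) action_operad_scheme \<Rightarrow> ('p, 'g, 'n) equiv_operad_scheme \<Rightarrow> 'x set
    \<Rightarrow> (nat \<Rightarrow> 'p \<Rightarrow> 'x list \<Rightarrow> 'x) \<Rightarrow> nat \<Rightarrow> ('p \<times> 'x list) set \<Rightarrow> 'x" where
  "map_to_alg L P X f n = (\<lambda>c \<in> alg_tensor L P X n. the_elem ((\<lambda>(p, xs). f n p xs) ` c))"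

text \<open>The formula is forced by equivariance, since \<open>\<tau>\<close> acts on the
  endomorphism operad by precomposition with \<open>perm_tuple \<tau>\<close>.\<close>

definition alg_to_sym_map ::
  "('g, 'm) action_operad_scheme \<Rightarrow> ('p, 'g, 'n) equiv_operad_scheme \<Rightarrow> 'x set
    \<Rightarrow> (nat \<Rightarrow> ('p \<times> 'x list) set \<Rightarrow> 'x)
    \<Rightarrow> nat \<Rightarrow> ('p \<times> (nat \<Rightarrow> nat)) set \<Rightarrow> 'x list \<Rightarrow> 'x" where
  "alg_to_sym_map L P X \<alpha> n = (\<lambda>c \<in> ops (pi_shriek L P) n.
     the_elem ((\<lambda>(p, \<tau>). \<lambda>xs \<in> tuples X n. alg_tilde L P X \<alpha> n p (perm_tuple \<tau> xs)) ` c))"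

lemma equiv_operad_mapsD:
  assumes "f \<in> equiv_operad_maps L P Q"
  shows "f n \<in> extensional (ops P n)"
    and "p \<in> ops P n \<Longrightarrow> f n p \<in> ops Q n"
    and "f 1 (opid P) = opid Q"
    and "\<lbrakk>p \<in> ops P (length ks); op_tuple P ks qs\<rbrakk>
      \<Longrightarrow> f (sum_list ks) (mu P ks p qs) = mu Q ks (f (length ks) p) (map2 f ks qs)"
    and "\<lbrakk>p \<in> ops P n; g \<in> ops L n\<rbrakk> \<Longrightarrow> f n (act P n p g) = act Q n (f n p) g"
  using assms by (auto simp: equiv_operad_maps_def operad_hom_def)

lemma equiv_operad_mapsI:
  assumes "\<And>n. f n \<in> extensional (ops P n)"
    and "\<And>n p. p \<in> ops P n \<Longrightarrow> f n p \<in> ops Q n"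
    and "f 1 (opid P) = opid Q"
    and "\<And>ks p qs. \<lbrakk>p \<in> ops P (length ks); op_tuple P ks qs\<rbrakk>
      \<Longrightarrow> f (sum_list ks) (mu P ks p qs) = mu Q ks (f (length ks) p) (map2 f ks qs)"
    and "\<And>n p g. \<lbrakk>p \<in> ops P n; g \<in> ops L n\<rbrakk> \<Longrightarrow> f n (act P n p g) = act Q n (f n p) g"
  shows "f \<in> equiv_operad_maps L P Q"
  using assms by (auto simp: equiv_operad_maps_def operad_hom_def)

lemma algebra_structuresD:
  assumes "\<alpha> \<in> algebra_structures L P X"
  shows "\<alpha> n \<in> alg_tensor L P X n \<rightarrow>\<^sub>E X"
    and "x \<in> X \<Longrightarrow> alg_tilde L P X \<alpha> 1 (opid P) [x] = x"
    and "\<lbrakk>p \<in> ops P (length ks); op_tuple P ks qs;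
        list_all2 (\<lambda>k xs. xs \<in> tuples X k) ks xss\<rbrakk>
      \<Longrightarrow> alg_tilde L P X \<alpha> (length ks) p
            (map (\<lambda>i. alg_tilde L P X \<alpha> (ks ! i) (qs ! i) (xss ! i)) [0..<length ks])
          = alg_tilde L P X \<alpha> (sum_list ks) (mu P ks p qs) (concat xss)"
  using assms by (simp_all add: algebra_structures_def)

context equivariant_operad
begin

lemma equiv_alg_rel: "equiv (ops P n \<times> tuples X n) (alg_rel L P X n)"
  unfolding alg_rel_def by (rule equiv_tensor_rel)

lemma alg_class_closed:
  "\<lbrakk>p \<in> ops P n; xs \<in> tuples X n\<rbrakk> \<Longrightarrow> alg_rel L P X n `` {(p, xs)} \<in> alg_tensor L P X n"
  unfolding alg_tensor_def by (rule quotientI) simp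

text \<open>The two pairs lie in one class of the tensor product, and \<open>\<alpha>\<close> is
  evaluated on classes; this holds for every \<open>\<alpha>\<close>.\<close>

lemma alg_tilde_act:
  assumes "p \<in> ops P n" "g \<in> ops L n" "xs \<in> tuples X n"
  shows "alg_tilde L P X \<alpha> n (act P n p g) xs = alg_tilde L P X \<alpha> n p (perm_tuple (perm L n g) xs)"
proof -
  have "((act P n p g, xs), (p, perm_tuple (perm L n g) xs)) \<in> alg_rel L P X n"
    unfolding alg_rel_def using assms
    by (intro tensor_relI[where la = "\<lambda>g. perm_tuple (perm L n g)"] act_closed
        perm_tuple_tuples L.perm_permutes)
  then show ?thesis
    unfolding alg_tilde_def by (simp add: equiv_class_eq[OF equiv_alg_rel])
qed

lemma alg_tilde_closed:
  "\<lbrakk>\<alpha> \<in> algebra_structures L P X; p \<in> ops P n; xs \<in> tuples X n\<rbrakk>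
    \<Longrightarrow> alg_tilde L P X \<alpha> n p xs \<in> X"
  unfolding alg_tilde_def by (rule PiE_mem[OF algebra_structuresD(1) alg_class_closed])

text \<open>Every class has a representative, and off the tensor product both structures are
  \<open>undefined\<close>.\<close>

lemma algebra_structures_eqI:
  assumes \<alpha>: "\<alpha> \<in> algebra_structures L P X" and \<alpha>': "\<alpha>' \<in> algebra_structures L P X"
    and eq: "\<And>n p xs. \<lbrakk>p \<in> ops P n; xs \<in> tuples X n\<rbrakk>
      \<Longrightarrow> alg_tilde L P X \<alpha> n p xs = alg_tilde L P X \<alpha>' n p xs"
  shows "\<alpha> = \<alpha>'"
proof
  fix n
  show "\<alpha> n = \<alpha>' n"
  proof (rule PiE_ext[OF algebra_structuresD(1)[OF \<alpha>] algebra_structuresD(1)[OF \<alpha>']])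
    fix c assume "c \<in> alg_tensor L P X n"
    then obtain p xs where "p \<in> ops P n" "xs \<in> tuples X n" "c = alg_rel L P X n `` {(p, xs)}"
      unfolding alg_tensor_def by (auto elim!: quotientE)
    then show "\<alpha> n c = \<alpha>' n c"
      using eq by (simp add: alg_tilde_def)
  qed
qed

text \<open>Adapts the composition law to \<open>end_operad\<close>, whose \<open>mu\<close> cuts up
  one long tuple, whereas the law concatenates given ones.\<close>

lemma alg_tilde_mu:
  assumes \<alpha>: "\<alpha> \<in> algebra_structures L P X"
    and p: "p \<in> ops P (length ks)" and qs: "op_tuple P ks qs"
    and xs: "xs \<in> tuples X (sum_list ks)"
  shows "alg_tilde L P X \<alpha> (sum_list ks) (mu P ks p qs) xs
    = alg_tilde L P X \<alpha> (length ks) p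
        (map (\<lambda>i. alg_tilde L P X \<alpha> (ks ! i) (qs ! i) (split_blocks ks xs ! i)) [0..<length ks])"
  using algebra_structuresD(3)[OF \<alpha> p qs tuples_split_blocks[OF xs]] xs
  by (simp add: tuples_def)

lemma alg_tilde_tuple:
  assumes \<alpha>: "\<alpha> \<in> algebra_structures L P X" and qs: "op_tuple P ks qs"
    and xss: "list_all2 (\<lambda>k xs. xs \<in> tuples X k) ks xss"
  shows "map (\<lambda>i. alg_tilde L P X \<alpha> (ks ! i) (qs ! i) (xss ! i)) [0..<length ks]
    \<in> tuples X (length ks)"
  using alg_tilde_closed[OF \<alpha> op_tuple_nth[OF qs] list_all2_nthD[OF xss]]
  by (subst tuples_def) auto

section \<open>The bijection with maps into the pulled-back endomorphism operad\<close>

lemma alg_to_map_closed: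
  assumes \<alpha>: "\<alpha> \<in> algebra_structures L P X"
  shows "alg_to_map L P X \<alpha> \<in> equiv_operad_maps L P (pi_star L (end_operad X))"
proof (rule equiv_operad_mapsI)
  show "alg_to_map L P X \<alpha> n \<in> extensional (ops P n)" for n
    by (simp add: alg_to_map_def)
  show "alg_to_map L P X \<alpha> n p \<in> ops (pi_star L (end_operad X)) n" if "p \<in> ops P n" for n p
    using that alg_tilde_closed[OF \<alpha>] by (auto simp: alg_to_map_def)
  show "alg_to_map L P X \<alpha> 1 (opid P) = opid (pi_star L (end_operad X))"
  proof
    fix xs
    show "alg_to_map L P X \<alpha> 1 (opid P) xs = opid (pi_star L (end_operad X)) xs"
      using opid_closed algebra_structuresD(2)[OF \<alpha>]
      by (cases "xs \<in> tuples X 1") (auto simp: alg_to_map_def elim!: tuples_one_cases)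
  qed
next
  fix ks p qs
  assume p: "p \<in> ops P (length ks)" and qs: "op_tuple P ks qs"
  show "alg_to_map L P X \<alpha> (sum_list ks) (mu P ks p qs)
      = mu (pi_star L (end_operad X)) ks (alg_to_map L P X \<alpha> (length ks) p)
          (map2 (alg_to_map L P X \<alpha>) ks qs)"
  proof
    fix xs
    show "alg_to_map L P X \<alpha> (sum_list ks) (mu P ks p qs) xs
      = mu (pi_star L (end_operad X)) ks (alg_to_map L P X \<alpha> (length ks) p)
          (map2 (alg_to_map L P X \<alpha>) ks qs) xs"
    proof (cases "xs \<in> tuples X (sum_list ks)")
      case True
      note xss = tuples_split_blocks[OF True]
      have "map2 (\<lambda>h ys. h ys) (map2 (alg_to_map L P X \<alpha>) ks qs) (split_blocks ks xs)
          = map (\<lambda>i. alg_tilde L P X \<alpha> (ks ! i) (qs ! i) (split_blocks ks xs ! i)) [0..<length ks]"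
        using op_tuple_length[OF qs] op_tuple_nth[OF qs] list_all2_nthD[OF xss]
        by (intro nth_equalityI) (simp_all add: alg_to_map_def)
      then show ?thesis
        using True mu_closed[OF p qs] p alg_tilde_mu[OF \<alpha> p qs True] alg_tilde_tuple[OF \<alpha> qs xss]
        by (simp add: alg_to_map_def)
    next
      \<comment> \<open>Off the tuples both sides are \<open>undefined\<close>, being restricted
        functions.\<close>
      case False
      then show ?thesis
        using mu_closed[OF p qs] by (simp add: alg_to_map_def)
    qed
  qed
next
  fix n p g
  assume p: "p \<in> ops P n" and g: "g \<in> ops L n"
  show "alg_to_map L P X \<alpha> n (act P n p g) = act (pi_star L (end_operad X)) n (alg_to_map L P X \<alpha> n p) g"
    using p g
    by (auto simp: alg_to_map_def act_closed alg_tilde_act perm_tuple_tuples L.perm_permutes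
        fun_eq_iff restrict_def)
qed

text \<open>Equivariance into \<open>pi_star\<close> says that acting on the operation amounts to
  permuting the arguments; hence \<open>f\<close> is balanced and descends to classes.\<close>

lemma alg_tilde_map_to_alg:
  assumes f: "f \<in> equiv_operad_maps L P (pi_star L (end_operad X))"
    and p: "p \<in> ops P n" and xs: "xs \<in> tuples X n"
  shows "alg_tilde L P X (map_to_alg L P X f) n p xs = f n p xs"
proof -
  have "f n p xs = (case v of (p, xs) \<Rightarrow> f n p xs)" if "((p, xs), v) \<in> alg_rel L P X n" for v
    using tensor_rel_respects[OF that[unfolded alg_rel_def], of "\<lambda>(p, xs). f n p xs"]
    by (simp add: equiv_operad_mapsD(5)[OF f])
  then have "the_elem ((\<lambda>(p, xs). f n p xs) ` (alg_rel L P X n `` {(p, xs)})) = f n p xs"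
    using the_elem_image_class[OF equiv_alg_rel, of "(p, xs)" n X "\<lambda>(p, xs). f n p xs"] p xs
    by simp
  then show ?thesis
    using alg_class_closed[OF p xs] by (simp add: alg_tilde_def map_to_alg_def)
qed

lemma map_to_alg_closed:
  assumes f: "f \<in> equiv_operad_maps L P (pi_star L (end_operad X))"
  shows "map_to_alg L P X f \<in> algebra_structures L P X"
proof -
  note tilde = alg_tilde_map_to_alg[OF f]
  have mem: "f n p xs \<in> X" if "p \<in> ops P n" "xs \<in> tuples X n" for n p xs
    using equiv_operad_mapsD(2)[OF f that(1)] that(2) by auto
  have "map_to_alg L P X f n \<in> alg_tensor L P X n \<rightarrow>\<^sub>E X" for n
  proof (rule PiE_I)
    fix c assume "c \<in> alg_tensor L P X n"
    then obtain p xs where "p \<in> ops P n" "xs \<in> tuples X n" "c = alg_rel L P X n `` {(p, xs)}"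
      unfolding alg_tensor_def by (auto elim!: quotientE)
    then show "map_to_alg L P X f n c \<in> X"
      using tilde mem by (simp add: alg_tilde_def)
  qed (simp add: map_to_alg_def)
  moreover have "alg_tilde L P X (map_to_alg L P X f) 1 (opid P) [x] = x" if "x \<in> X" for x
  proof -
    have x: "[x] \<in> tuples X 1"
      using that by (simp add: tuples_def)
    then show ?thesis
      using tilde[OF opid_closed x] equiv_operad_mapsD(3)[OF f] by simp
  qed
  moreover have "alg_tilde L P X (map_to_alg L P X f) (length ks) p
        (map (\<lambda>i. alg_tilde L P X (map_to_alg L P X f) (ks ! i) (qs ! i) (xss ! i)) [0..<length ks])
      = alg_tilde L P X (map_to_alg L P X f) (sum_list ks) (mu P ks p qs) (concat xss)"
    if p: "p \<in> ops P (length ks)" and qs: "op_tuple P ks qs"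
      and xss: "list_all2 (\<lambda>k xs. xs \<in> tuples X k) ks xss" for ks p qs xss
  proof -
    let ?ys = "map (\<lambda>i. f (ks ! i) (qs ! i) (xss ! i)) [0..<length ks]"
    have len: "map length xss = ks" and cat: "concat xss \<in> tuples X (sum_list ks)"
      using tuples_concat[OF xss] by simp_all
    \<comment> \<open>The arities are the lengths of the blocks, so the cut made by
      \<open>mu\<close> of \<open>end_operad\<close> recovers the given tuples.\<close>
    have split: "split_blocks ks (concat xss) = xss"
      using split_blocks_concat[of xss] by (simp add: len)
    have nth: "qs ! i \<in> ops P (ks ! i)" "xss ! i \<in> tuples X (ks ! i)" if "i < length ks" for i
      using op_tuple_nth[OF qs that] list_all2_nthD[OF xss that] by simp_all
    have ys: "?ys \<in> tuples X (length ks)"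
      using mem nth by (subst tuples_def) auto
    have "map2 (\<lambda>h ys. h ys) (map2 f ks qs) xss = ?ys"
      using op_tuple_length[OF qs] list_all2_lengthD[OF xss]
      by (intro nth_equalityI) simp_all
    then have "f (sum_list ks) (mu P ks p qs) (concat xss) = f (length ks) p ?ys"
      using equiv_operad_mapsD(4)[OF f p qs] cat by (simp add: split)
    moreover have "map (\<lambda>i. alg_tilde L P X (map_to_alg L P X f) (ks ! i) (qs ! i) (xss ! i))
        [0..<length ks] = ?ys"
      using nth by (simp add: tilde)
    ultimately show ?thesis
      by (simp only: tilde[OF p ys] tilde[OF mu_closed[OF p qs] cat])
  qed
  ultimately show ?thesis
    by (simp add: algebra_structures_def)
qed

lemma bij_betw_alg_to_map:
  "bij_betw (alg_to_map L P X) (algebra_structures L P X)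
    (equiv_operad_maps L P (pi_star L (end_operad X)))"
proof (rule bij_betw_byWitness[where f' = "map_to_alg L P X"])
  show "\<forall>\<alpha> \<in> algebra_structures L P X. map_to_alg L P X (alg_to_map L P X \<alpha>) = \<alpha>"
  proof
    fix \<alpha> assume \<alpha>: "\<alpha> \<in> algebra_structures L P X"
    note f = alg_to_map_closed[OF \<alpha>]
    show "map_to_alg L P X (alg_to_map L P X \<alpha>) = \<alpha>"
      by (rule algebra_structures_eqI[OF map_to_alg_closed[OF f] \<alpha>])
        (simp add: alg_tilde_map_to_alg[OF f], simp add: alg_to_map_def)
  qed
  show "\<forall>f \<in> equiv_operad_maps L P (pi_star L (end_operad X)).
      alg_to_map L P X (map_to_alg L P X f) = f"
  proof (intro ballI ext)
    fix f n p xs assume f: "f \<in> equiv_operad_maps L P (pi_star L (end_operad X))"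
    show "alg_to_map L P X (map_to_alg L P X f) n p xs = f n p xs"
    \<comment> \<open>The functions must agree at all arguments: off the operations and off the
      tuples, extensionality makes both sides \<open>undefined\<close>.\<close>
    proof (cases "p \<in> ops P n")
      case True
      then show ?thesis
        using equiv_operad_mapsD(2)[OF f True] PiE_arb[of "f n p" "tuples X n" "\<lambda>_. X" xs]
        by (cases "xs \<in> tuples X n") (simp_all add: alg_to_map_def alg_tilde_map_to_alg[OF f])
    next
      case False
      then show ?thesis
        using extensional_arb[OF equiv_operad_mapsD(1)[OF f] False] by (simp add: alg_to_map_def)
    qed
  qed
qed (use alg_to_map_closed map_to_alg_closed in blast)+

section \<open>The bijection with symmetric operad maps out of \<open>pi_shriek L P\<close>\<close>

lemma alg_to_sym_map_class:
  assumes p: "p \<in> ops P n" and \<tau>: "\<tau> permutes {..<n}"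
  shows "alg_to_sym_map L P X \<alpha> n (pi_shriek_class L P n p \<tau>)
    = (\<lambda>xs \<in> tuples X n. alg_tilde L P X \<alpha> n p (perm_tuple \<tau> xs))"
proof -
  let ?h = "\<lambda>(p, \<tau>). \<lambda>xs \<in> tuples X n. alg_tilde L P X \<alpha> n p (perm_tuple \<tau> xs)"
  have "?h (p, \<tau>) = ?h v" if "((p, \<tau>), v) \<in> pi_shriek_rel L P n" for v
  proof (rule tensor_rel_respects[OF that[unfolded pi_shriek_rel_def]])
    fix a g b assume *: "a \<in> ops P n" "g \<in> ops L n" "b \<in> ops sym_operad n"
    \<comment> \<open>The element \<open>g\<close> leaves the operation and acts on the tuple
      already permuted by \<open>b\<close>; since \<open>perm_tuple\<close> is a left action, the
      two merge into \<open>perm L n g \<circ> b\<close>.\<close>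
    have "alg_tilde L P X \<alpha> n (act P n a g) (perm_tuple b xs)
        = alg_tilde L P X \<alpha> n a (perm_tuple (perm L n g \<circ> b) xs)" if "xs \<in> tuples X n" for xs
      using alg_tilde_act[of a n g "perm_tuple b xs"] perm_tuple_tuples[of b n xs X]
        perm_tuple_comp[of "perm L n g" xs b] * that L.perm_permutes
      by (simp add: tuples_def)
    then show "?h (act P n a g, b) = ?h (a, perm L n g \<circ> b)"
      by (auto simp: restrict_def)
  qed
  then have "the_elem (?h ` pi_shriek_class L P n p \<tau>) = ?h (p, \<tau>)"
    unfolding pi_shriek_class_def using p \<tau>
    by (intro the_elem_image_class[OF equiv_pi_shriek_rel]) simp_all
  then show ?thesis
    using pi_shriek_class_closed[OF p \<tau>] by (simp add: alg_to_sym_map_def)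
qed

text \<open>The substantial point is compatibility with \<open>mu\<close>:
  \<open>perm_tuple_sigma_mu\<close> writes the permuted argument as a concatenation whose blocks
  stand in the order of the reordered operations, so the composition law applies with arities
  \<open>perm_tuple \<tau> ks\<close>.\<close>

lemma alg_to_sym_map_closed:
  fixes X :: "'x set"
  assumes \<alpha>: "\<alpha> \<in> algebra_structures L P X"
  shows "alg_to_sym_map L P X \<alpha> \<in> sym_operad_maps (pi_shriek L P) (end_operad X)"
proof (rule equiv_operad_mapsI)
  show "alg_to_sym_map L P X \<alpha> n \<in> extensional (ops (pi_shriek L P) n)" for n
    by (simp add: alg_to_sym_map_def)
  show "alg_to_sym_map L P X \<alpha> n c \<in> ops (end_operad X) n"
    if c: "c \<in> ops (pi_shriek L P) n" for n c
  proof -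
    obtain p \<tau> where "p \<in> ops P n" "\<tau> permutes {..<n}" "c = pi_shriek_class L P n p \<tau>"
      using pi_shriek_cases[OF c] .
    then show ?thesis
      by (auto simp: alg_to_sym_map_class intro: alg_tilde_closed[OF \<alpha>] perm_tuple_tuples)
  qed
  show "alg_to_sym_map L P X \<alpha> 1 (opid (pi_shriek L P)) = opid (end_operad X)"
    using alg_to_sym_map_class[OF opid_closed permutes_id, of X \<alpha>] algebra_structuresD(2)[OF \<alpha>]
    by (auto simp: pi_shriek_def restrict_def fun_eq_iff elim!: tuples_one_cases)
next
  fix n c \<sigma>
  assume c: "c \<in> ops (pi_shriek L P) n" and \<sigma>: "\<sigma> \<in> ops sym_operad n"
  obtain p \<tau> where p: "p \<in> ops P n" and \<tau>: "\<tau> permutes {..<n}"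
    and c_eq: "c = pi_shriek_class L P n p \<tau>"
    using pi_shriek_cases[OF c] .
  have "perm_tuple (\<tau> \<circ> \<sigma>) xs = perm_tuple \<tau> (perm_tuple \<sigma> xs)"
    "perm_tuple \<sigma> xs \<in> tuples X n" if "xs \<in> tuples X n" for xs :: "'x list"
    using that \<tau> \<sigma> perm_tuple_tuples[of \<sigma> n xs X] by (simp_all add: tuples_def perm_tuple_comp)
  then show "alg_to_sym_map L P X \<alpha> n (act (pi_shriek L P) n c \<sigma>)
      = act (end_operad X) n (alg_to_sym_map L P X \<alpha> n c) \<sigma>"
    using p \<tau> \<sigma>
    by (auto simp: c_eq pi_shriek_act_class alg_to_sym_map_class permutes_compose restrict_def
        fun_eq_iff)
next
  fix ks c cs
  assume c: "c \<in> ops (pi_shriek L P) (length ks)" and cs: "op_tuple (pi_shriek L P) ks cs"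
  obtain p \<tau> where p: "p \<in> ops P (length ks)" and \<tau>: "\<tau> permutes {..<length ks}"
    and c_eq: "c = pi_shriek_class L P (length ks) p \<tau>"
    using pi_shriek_cases[OF c] .
  obtain qs \<tau>s where qs: "op_tuple P ks qs" and \<tau>s: "op_tuple sym_operad ks \<tau>s"
    and cs_eq: "cs = map (\<lambda>i. pi_shriek_class L P (ks ! i) (qs ! i) (\<tau>s ! i)) [0..<length ks]"
    using op_tuple_pi_shriek_cases[OF cs] .
  let ?ks = "perm_tuple \<tau> ks" and ?qs = "perm_tuple \<tau> qs" and ?N = "sum_list ks"
  have len: "length qs = length ks" "length \<tau>s = length ks"
    using qs \<tau>s by (simp_all add: op_tuple_length)
  have N: "sum_list ?ks = ?N"
    using \<tau> by (rule sum_list_perm_tuple)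
  have qs': "op_tuple P ?ks ?qs"
    using \<tau> qs by (rule op_tuple_perm_tuple)
  have p': "p \<in> ops P (length ?ks)"
    using p by simp
  have q: "mu P ?ks p ?qs \<in> ops P ?N"
    using mu_closed[OF p' qs'] by (simp add: N)
  have \<tau>s_nth: "(\<tau>s ! i) permutes {..<ks ! i}" if "i < length ks" for i
    using op_tuple_nth[OF \<tau>s that] by simp
  have tilde: "alg_tilde L P X \<alpha> ?N (mu P ?ks p ?qs) (perm_tuple (sigma_mu ks \<tau> \<tau>s) xs)
      = alg_to_sym_map L P X \<alpha> (length ks) c
          (map2 (\<lambda>h ys. h ys) (map2 (alg_to_sym_map L P X \<alpha>) ks cs) (split_blocks ks xs))"
    if xs: "xs \<in> tuples X ?N" for xs
  proof -
    define xss where "xss = split_blocks ks xs"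
    have xss: "list_all2 (\<lambda>k ys. ys \<in> tuples X k) ks xss"
      unfolding xss_def by (rule tuples_split_blocks[OF xs])
    have lx: "length xss = length ks" and lens: "map length xss = ks" and cat: "concat xss = xs"
      using tuples_concat[OF xss] xs by (simp_all add: xss_def tuples_def)
    have xss_nth: "xss ! i \<in> tuples X (ks ! i)" if "i < length ks" for i
      using list_all2_nthD[OF xss that] .
    define yss where "yss = map2 perm_tuple \<tau>s xss"
    have yss: "list_all2 (\<lambda>k ys. ys \<in> tuples X k) ks yss"
      using len lx xss_nth \<tau>s_nth
      by (auto simp: yss_def list_all2_conv_all_nth intro: perm_tuple_tuples)
    define zs where "zs = map (\<lambda>i. alg_tilde L P X \<alpha> (ks ! i) (qs ! i) (yss ! i)) [0..<length ks]"
    have zs: "zs \<in> tuples X (length ks)"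
      unfolding zs_def by (rule alg_tilde_tuple[OF \<alpha> qs yss])
    have "perm_tuple (sigma_mu ks \<tau> \<tau>s) xs = concat (perm_tuple \<tau> yss)"
      using perm_tuple_sigma_mu[of \<tau> xss \<tau>s] \<tau> \<tau>s lx by (simp add: lens cat yss_def)
    moreover have "list_all2 (\<lambda>k ys. ys \<in> tuples X k) ?ks (perm_tuple \<tau> yss)"
      using \<tau> yss by (rule list_all2_perm_tuple)
    ultimately have "alg_tilde L P X \<alpha> ?N (mu P ?ks p ?qs) (perm_tuple (sigma_mu ks \<tau> \<tau>s) xs)
        = alg_tilde L P X \<alpha> (length ks) p
            (map (\<lambda>i. alg_tilde L P X \<alpha> (?ks ! i) (?qs ! i) (perm_tuple \<tau> yss ! i)) [0..<length ks])"
      using algebra_structuresD(3)[OF \<alpha> p' qs'] by (simp add: N)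
    \<comment> \<open>Operations and blocks are reordered by the same \<open>\<tau>\<close>, so the
      inner values are those of the original slots, reordered.\<close>
    also have "map (\<lambda>i. alg_tilde L P X \<alpha> (?ks ! i) (?qs ! i) (perm_tuple \<tau> yss ! i)) [0..<length ks]
        = perm_tuple \<tau> zs"
      using \<tau> len list_all2_lengthD[OF yss]
      by (intro nth_equalityI) (simp_all add: zs_def nth_perm_tuple inv_permutes_lessThan_less)
    also have "alg_tilde L P X \<alpha> (length ks) p (perm_tuple \<tau> zs)
        = alg_to_sym_map L P X \<alpha> (length ks) c zs"
      using zs by (simp add: c_eq alg_to_sym_map_class[OF p \<tau>])
    also have "zs = map2 (\<lambda>h ys. h ys) (map2 (alg_to_sym_map L P X \<alpha>) ks cs) xss"
      using len lx op_tuple_nth[OF qs] \<tau>s_nth xss_nth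
      by (intro nth_equalityI) (simp_all add: zs_def yss_def cs_eq alg_to_sym_map_class)
    finally show ?thesis
      by (simp add: xss_def)
  qed
  have mu_eq: "mu (pi_shriek L P) ks c cs
      = pi_shriek_class L P ?N (mu P ?ks p ?qs) (sigma_mu ks \<tau> \<tau>s)"
    using pi_shriek_mu_class[OF p \<tau> qs \<tau>s] by (simp add: c_eq cs_eq)
  show "alg_to_sym_map L P X \<alpha> ?N (mu (pi_shriek L P) ks c cs)
      = mu (end_operad X) ks (alg_to_sym_map L P X \<alpha> (length ks) c)
          (map2 (alg_to_sym_map L P X \<alpha>) ks cs)"
    unfolding mu_eq alg_to_sym_map_class[OF q sigma_mu_permutes[OF \<tau> \<tau>s]] end_operad_simps
    by (rule restrict_ext) (rule tilde)
qed

lemma pi_shriek_opid: "opid (pi_shriek L P) = pi_shriek_class L P 1 (opid P) id"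
  by (simp add: pi_shriek_def)

text \<open>One direction of the adjunction between \<open>pi_shriek\<close> and
  \<open>pi_star\<close>: restriction along the unit sending \<open>p\<close> to
  \<open>[p, e]\<close>. The unit is equivariant because \<open>[p \<cdot> g, e]\<close>,
  \<open>[p, \<pi>(g)]\<close> and \<open>[p, e] \<cdot> \<pi>(g)\<close> are the same
  class.\<close>

lemma sym_map_restrict_closed:
  assumes f: "f \<in> sym_operad_maps (pi_shriek L P) Q"
  shows "(\<lambda>n. \<lambda>p \<in> ops P n. f n (pi_shriek_class L P n p id))
    \<in> equiv_operad_maps L P (pi_star L Q)" (is "?F \<in> _")
proof (rule equiv_operad_mapsI)
  show "?F n p \<in> ops (pi_star L Q) n" if "p \<in> ops P n" for n p
    using that equiv_operad_mapsD(2)[OF f pi_shriek_class_closed[OF that permutes_id]] by simp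
  show "?F 1 (opid P) = opid (pi_star L Q)"
    using opid_closed equiv_operad_mapsD(3)[OF f] by (simp add: pi_shriek_opid)
next
  fix ks p qs
  assume p: "p \<in> ops P (length ks)" and qs: "op_tuple P ks qs"
  let ?cs = "map (\<lambda>i. pi_shriek_class L P (ks ! i) (qs ! i) (map (\<lambda>_. id) ks ! i)) [0..<length ks]"
  have cs: "op_tuple (pi_shriek L P) ks ?cs"
    using op_tuple_nth[OF qs] by (intro op_tuple_mapI) (simp add: pi_shriek_class_closed permutes_id)
  have "map2 f ks ?cs = map2 ?F ks qs"
    using op_tuple_nth[OF qs] op_tuple_length[OF qs] by (intro nth_equalityI) simp_all
  then show "?F (sum_list ks) (mu P ks p qs)
      = mu (pi_star L Q) ks (?F (length ks) p) (map2 ?F ks qs)"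
    using equiv_operad_mapsD(4)[OF f pi_shriek_class_closed[OF p permutes_id] cs]
      pi_shriek_mu_class[OF p permutes_id qs op_tuple_id] p mu_closed[OF p qs]
    by (simp add: sigma_mu_id)
next
  fix n p g
  assume p: "p \<in> ops P n" and g: "g \<in> ops L n"
  note \<sigma> = L.perm_permutes[OF g]
  have "pi_shriek_class L P n (act P n p g) id
      = act (pi_shriek L P) n (pi_shriek_class L P n p id) (perm L n g)"
    using pi_shriek_class_act[OF p g permutes_id] pi_shriek_act_class[OF p permutes_id \<sigma>] by simp
  then have "f n (pi_shriek_class L P n (act P n p g) id)
      = f n (act (pi_shriek L P) n (pi_shriek_class L P n p id) (perm L n g))"
    by (rule arg_cong)
  also have "\<dots> = act Q n (f n (pi_shriek_class L P n p id)) (perm L n g)"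
    using \<sigma> by (intro equiv_operad_mapsD(5)[OF f pi_shriek_class_closed[OF p permutes_id]]) simp
  finally show "?F n (act P n p g) = act (pi_star L Q) n (?F n p) g"
    using p g act_closed[OF p g] by simp
qed simp

text \<open>Injectivity is tested on classes with identity permutation, where the value is
  \<open>alg_tilde\<close> itself. For surjectivity the algebra comes from restricting
  \<open>f\<close> to these classes, and equivariance carries the agreement to all others.\<close>

lemma bij_betw_alg_to_sym_map:
  fixes X :: "'x set"
  shows "bij_betw (alg_to_sym_map L P X) (algebra_structures L P X)
    (sym_operad_maps (pi_shriek L P) (end_operad X))"
  unfolding bij_betw_def
proof (intro conjI inj_onI equalityI)
  fix \<alpha> \<alpha>' assume \<alpha>: "\<alpha> \<in> algebra_structures L P X" "\<alpha>' \<in> algebra_structures L P X"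
    and eq: "alg_to_sym_map L P X \<alpha> = alg_to_sym_map L P X \<alpha>'"
  show "\<alpha> = \<alpha>'"
  proof (rule algebra_structures_eqI[OF \<alpha>])
    fix n p and xs :: "'x list" assume "p \<in> ops P n" "xs \<in> tuples X n"
    then show "alg_tilde L P X \<alpha> n p xs = alg_tilde L P X \<alpha>' n p xs"
      using fun_cong[OF alg_to_sym_map_class[OF _ permutes_id, of p n X \<alpha>], of xs]
        fun_cong[OF alg_to_sym_map_class[OF _ permutes_id, of p n X \<alpha>'], of xs]
      by (simp add: eq)
  qed
next
  show "sym_operad_maps (pi_shriek L P) (end_operad X)
    \<subseteq> alg_to_sym_map L P X ` algebra_structures L P X"
  proof
    fix f assume f: "f \<in> sym_operad_maps (pi_shriek L P) (end_operad X)"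
    define F where "F = (\<lambda>n. \<lambda>p \<in> ops P n. f n (pi_shriek_class L P n p id))"
    define \<alpha> where "\<alpha> = map_to_alg L P X F"
    have F: "F \<in> equiv_operad_maps L P (pi_star L (end_operad X))"
      unfolding F_def by (rule sym_map_restrict_closed[OF f])
    have \<alpha>: "\<alpha> \<in> algebra_structures L P X"
      unfolding \<alpha>_def by (rule map_to_alg_closed[OF F])
    have "alg_to_sym_map L P X \<alpha> n c = f n c" for n c
    proof (cases "c \<in> ops (pi_shriek L P) n")
      case True
      then obtain p \<tau> where p: "p \<in> ops P n" and \<tau>: "\<tau> permutes {..<n}"
        and c: "c = pi_shriek_class L P n p \<tau>"
        by (rule pi_shriek_cases)
      have "f n c = f n (act (pi_shriek L P) n (pi_shriek_class L P n p id) \<tau>)"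
        using pi_shriek_act_class[OF p permutes_id \<tau>] by (simp add: c)
      also have "\<dots> = (\<lambda>xs \<in> tuples X n. f n (pi_shriek_class L P n p id) (perm_tuple \<tau> xs))"
        using equiv_operad_mapsD(5)[OF f pi_shriek_class_closed[OF p permutes_id], of \<tau>] \<tau> by simp
      also have "\<dots> = alg_to_sym_map L P X \<alpha> n c"
        unfolding c alg_to_sym_map_class[OF p \<tau>]
        using alg_tilde_map_to_alg[OF F p perm_tuple_tuples[OF \<tau>]] p
        by (auto simp: \<alpha>_def F_def)
      finally show ?thesis ..
    next
      case False
      then show ?thesis
        using extensional_arb[OF equiv_operad_mapsD(1)[OF f] False]
        by (simp add: alg_to_sym_map_def)
    qed
    then show "f \<in> alg_to_sym_map L P X ` algebra_structures L P X"
      using \<alpha> by (intro image_eqI[of f _ \<alpha>]) (simp_all add: fun_eq_iff)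
  qed
  show "alg_to_sym_map L P X ` algebra_structures L P X
    \<subseteq> sym_operad_maps (pi_shriek L P) (end_operad X)"
    by (rule image_subsetI) (rule alg_to_sym_map_closed)
qed

end

text \<open>The formulas for \<open>\<Phi>\<close> and \<open>\<Psi>\<close> belong to the claim,
  since bare bijections would only compare cardinalities.\<close>

theorem corollary8p21:
  fixes L :: "'g action_operad"
    and P :: "('p, 'g) equiv_operad"
    and X :: "'x set"
  assumes "action_operad L" and "equivariant_operad L P"
  shows "(\<exists>\<Phi>. bij_betw \<Phi> (algebra_structures L P X)
                  (equiv_operad_maps L P (pi_star L (end_operad X))) \<and>
            (\<forall>\<alpha> \<in> algebra_structures L P X. \<forall>n. \<forall>p \<in> ops P n. \<forall>xs \<in> tuples X n.
               \<Phi> \<alpha> n p xs = alg_tilde L P X \<alpha> n p xs)) \<and>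
         (\<exists>\<Psi>. bij_betw \<Psi> (algebra_structures L P X)
                  (sym_operad_maps (pi_shriek L P) (end_operad X)) \<and>
            (\<forall>\<alpha> \<in> algebra_structures L P X. \<forall>n. \<forall>p \<in> ops P n. \<forall>\<tau> \<in> ops sym_operad n.
               \<forall>xs \<in> tuples X n.
               \<Psi> \<alpha> n (pi_shriek_class L P n p \<tau>) xs = alg_tilde L P X \<alpha> n p (perm_tuple \<tau> xs)))"
proof -
  interpret equivariant_operad L P
    by fact
  show ?thesis
  proof (intro conjI exI)
    show "bij_betw (alg_to_map L P X) (algebra_structures L P X)
        (equiv_operad_maps L P (pi_star L (end_operad X)))"
      by (rule bij_betw_alg_to_map)
    show "bij_betw (alg_to_sym_map L P X) (algebra_structures L P X)
        (sym_operad_maps (pi_shriek L P) (end_operad X))"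
      by (rule bij_betw_alg_to_sym_map)
  qed (simp_all add: alg_to_map_def alg_to_sym_map_class)
qed

end
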